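(* Let $m\in\mathbb{N}$, $p\in(1,\infty)$, and let $E$ be a (nonempty) closed subset of $\mathbb{R}$. Suppose we are given a Whitney $(m-1)$-field $\mathbf{P}=\{P_x:x\in E\}$ defined on $E$. Then there exists a $C^{m-1}$-function $F\in L^m_p(\mathbb{R})$ such that $$T^{m-1}_x[F]=P_x\quad\text{for every }x\in E$$ if and only if the quantity $$\mathcal{N}_{m,p,E}(\mathbf{P})=\sup\left\{\sum_{j=1}^{k-1}\sum_{i=0}^{m-1}\frac{|P^{(i)}_{x_j}(x_j)-P^{(i)}_{x_{j+1}}(x_j)|^p}{(x_{j+1}-x_j)^{(m-i)p-1}}\right\}^{1/p}$$ is finite. Here the supremum is taken over all integers $k>1$ and all finite strictly increasing sequences $\{x_j\}_{j=1}^k\subset E$. Furthermore, $$\|\mathbf{P}\|_{m,p,E}\sim\mathcal{N}_{m,p,E}(\mathbf{P}),$$ with constants of equivalence depending only on $m$ (i.e. each side is at most $C$ times the other, with $C\ge1$ depending only on $m$).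
   Context: A Whitney $(m-1)$-field on $E$ is a family $\mathbf{P}=\{P_x:x\in E\}$ of polynomials $P_x$ on $\mathbb{R}$ of degree at most $m-1$ indexed by the points of $E$. $P_x^{(i)}$ denotes the $i$-th derivative of the polynomial $P_x$. For $F\in C^{m-1}(\mathbb{R})$, $T^{m-1}_x[F](y)=\sum_{k=0}^{m-1}\frac{1}{k!}F^{(k)}(x)(y-x)^k$ is the Taylor polynomial of $F$ of degree $m-1$ at $x$. $L^m_p(\mathbb{R})$ is the space of functions $F:\mathbb{R}\to\mathbb{R}$ such that $F^{(m-1)}$ exists and is (locally) absolutely continuous and $F^{(m)}\in L_p(\mathbb{R})$, seminormed by $\|F\|_{L^m_p(\mathbb{R})}=\|F^{(m)}\|_{L_p(\mathbb{R})}$. Finally, $$\|\mathbf{P}\|_{m,p,E}=\inf\{\|F\|_{L^m_p(\mathbb{R})}:F\in L^m_p(\mathbb{R}),\ T^{m-1}_x[F]=P_x\text{ for every }x\in E\}.$$ *)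

theory Defs
  imports "HOL-Analysis.Analysis" "HOL-Computational_Algebra.Polynomial"
begin

text \<open>The k-th derivative of F is \<open>(deriv ^^ k) F\<close>. As \<^const>\<open>deriv\<close> is total, the existence of
  derivatives is always demanded separately.\<close>

definition has_derivs :: "nat \<Rightarrow> (real \<Rightarrow> real) \<Rightarrow> bool" where
  "has_derivs n F \<longleftrightarrow> (\<forall>k<n. \<forall>x. (deriv ^^ k) F differentiable (at x))"

definition C_diff :: "nat \<Rightarrow> (real \<Rightarrow> real) \<Rightarrow> bool" where
  "C_diff n F \<longleftrightarrow> has_derivs n F \<and> continuous_on UNIV ((deriv ^^ n) F)"

definition abs_cont_on :: "real \<Rightarrow> real \<Rightarrow> (real \<Rightarrow> real) \<Rightarrow> bool" where
  "abs_cont_on a b f \<longleftrightarrow>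
     (\<forall>\<epsilon>>0. \<exists>\<delta>>0. \<forall>(n::nat) u v.
        (\<forall>i<n. a \<le> u i \<and> u i \<le> v i \<and> v i \<le> b) \<and>
        disjoint_family_on (\<lambda>i. {u i<..<v i}) {..<n} \<and>
        (\<Sum>i<n. v i - u i) < \<delta>
        \<longrightarrow> (\<Sum>i<n. \<bar>f (v i) - f (u i)\<bar>) < \<epsilon>)"

definition locally_abs_cont :: "(real \<Rightarrow> real) \<Rightarrow> bool" where
  "locally_abs_cont f \<longleftrightarrow> (\<forall>a b. a \<le> b \<longrightarrow> abs_cont_on a b f)"

definition in_Lp :: "real \<Rightarrow> (real \<Rightarrow> real) \<Rightarrow> bool" where
  "in_Lp p g \<longleftrightarrow> g \<in> borel_measurable lebesgue \<and> integrable lebesgue (\<lambda>x. \<bar>g x\<bar> powr p)"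

definition Lp_norm :: "real \<Rightarrow> (real \<Rightarrow> real) \<Rightarrow> real" where
  "Lp_norm p g = (LINT x|lebesgue. \<bar>g x\<bar> powr p) powr (1 / p)"

text \<open>Meant for \<open>m \<ge> 1\<close>. The m-th derivative exists only almost everywhere; off that set
  \<^const>\<open>deriv\<close> takes an irrelevant value. (By Lebesgue's theorem the almost everywhere
  condition follows from absolute continuity.)\<close>

definition sobolev :: "nat \<Rightarrow> real \<Rightarrow> (real \<Rightarrow> real) set" where
  "sobolev m p = {F. has_derivs (m - 1) F \<and> locally_abs_cont ((deriv ^^ (m - 1)) F) \<and>
     (AE x in lebesgue. (deriv ^^ (m - 1)) F differentiable (at x)) \<and>
     in_Lp p ((deriv ^^ m) F)}"

definition sobolev_seminorm :: "nat \<Rightarrow> real \<Rightarrow> (real \<Rightarrow> real) \<Rightarrow> real" where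
  "sobolev_seminorm m p F = Lp_norm p ((deriv ^^ m) F)"

definition taylor_poly :: "nat \<Rightarrow> real \<Rightarrow> (real \<Rightarrow> real) \<Rightarrow> real poly" where
  "taylor_poly n x F = (\<Sum>k\<le>n. smult ((deriv ^^ k) F x / fact k) ([:- x, 1:] ^ k))"

text \<open>A field on E is a function on all of \<^typ>\<open>real\<close> whose values outside E are ignored.\<close>

definition whitney_field :: "nat \<Rightarrow> real set \<Rightarrow> (real \<Rightarrow> real poly) \<Rightarrow> bool" where
  "whitney_field n E P \<longleftrightarrow> (\<forall>x\<in>E. degree (P x) \<le> n)"

text \<open>The infimum over the empty set is \<open>\<infinity>\<close>.\<close>

definition field_norm :: "nat \<Rightarrow> real \<Rightarrow> real set \<Rightarrow> (real \<Rightarrow> real poly) \<Rightarrow> ennreal" where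
  "field_norm m p E P =
     (INF F\<in>{F \<in> sobolev m p. \<forall>x\<in>E. taylor_poly (m - 1) x F = P x}.
        ennreal (sobolev_seminorm m p F))"

text \<open>The supremum over the empty set, which occurs for one-point E, is 0. The power \<open>1/p\<close> is
  taken inside the supremum.

  Both derivatives are evaluated at the same point \<open>x j\<close>. Evaluating the second one at
  \<open>x (j + 1)\<close> would compare values at different points: for \<open>m \<ge> 2\<close> and \<open>P x = [:0, 1:]\<close>
  for every x, that quantity is positive for \<open>E = {0, 1}\<close> and infinite for \<open>E = {0..1}\<close>, although
  \<open>F y = y\<close> realises the field with seminorm 0.\<close>

definition variation_quantity ::
    "nat \<Rightarrow> real \<Rightarrow> real set \<Rightarrow> (real \<Rightarrow> real poly) \<Rightarrow> ennreal" where
  "variation_quantity m p E P =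
     Sup {ennreal ((\<Sum>j=1..k-1. \<Sum>i=0..m-1.
              \<bar>poly ((pderiv ^^ i) (P (x j))) (x j)
                 - poly ((pderiv ^^ i) (P (x (j + 1)))) (x j)\<bar> powr p
              / (x (j + 1) - x j) powr ((real m - real i) * p - 1)) powr (1 / p))
          | (k::nat) x. k > 1 \<and> strict_mono_on {1..k} x \<and> x ` {1..k} \<subseteq> E}"

end

theory Submission
  imports Defs
begin

text \<open>Necessity: Taylor's formula bounds the jet differences at consecutive points \<open>x < y\<close> by the oscillation
  of \<open>F\<^sup>(\<^sup>m\<^sup>-\<^sup>1\<^sup>)\<close> on \<open>[x, y]\<close>, hence by \<open>\<integral> \<bar>F\<^sup>(\<^sup>m\<^sup>)\<bar>\<^sup>p\<close> over \<open>[x, y]\<close>, and these integrals add up.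

  Sufficiency: let \<open>W x\<close> be the supremum of the variation sums over sequences in \<open>E\<close> up to \<open>x\<close>. It is
  monotone and bounded, and \<open>W y - W x\<close> dominates the jet differences between \<open>x\<close> and \<open>y\<close>. Interpolate
  the field by polynomials in the gaps of \<open>E\<close> and \<open>W\<close> linearly. The top derivative \<open>G\<close> of the resulting
  function then satisfies \<open>\<bar>G y - G x\<bar>\<^sup>p \<le> C\<^sup>p (W y - W x) (y - x)\<^sup>p\<^sup>-\<^sup>1\<close> for all real \<open>x < y\<close>, a form of
  F. Riesz' characterisation of \<open>L\<^sup>1\<^sub>p\<close>. Since \<open>G + C (W + id)\<close> and \<open>C (W + id)\<close> are monotone, \<open>G\<close> is
  differentiable almost everywhere by Lebesgue's theorem, and Fatou's lemma bounds the norm of \<open>G'\<close>.\<close>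

section \<open>Lebesgue's differentiation theorem for monotone functions\<close>

text \<open>On \<open>E\<close> the m-th derivative of the extension has no formula, and
  \<open>E\<close> may have positive measure or accumulating gaps, so the norm cannot be assembled
  from integrals over gaps. An increment condition on the derivative of order \<open>m - 1\<close>,
  imposed on all pairs of reals, avoids this: it is checked either inside one gap or through one
  point \<open>e\<close> of \<open>E\<close> between the two arguments, where it helps that the
  derivative of order \<open>m - 1\<close> of the polynomial at \<open>e\<close> is constant. The
  supremum of the variation sums turns bounds along sequences into a bound for every single pair,
  with right sides that still add up. Linear interpolation of it fits the gaps: there the m-th
  derivative of the interpolant is at most a constant times the p-th root of the slope. All losses
  under a p-th power have the form \<open>c powr p\<close> or \<open>real m\<close>, so after the
  p-th root no constant depends on \<open>p\<close>.\<close>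

lemma sum_disjoint_intervals_mono:
  fixes f :: "real \<Rightarrow> real"
  assumes f: "mono f" and "finite I" and "a \<le> b"
    and I: "\<And>i. i \<in> I \<Longrightarrow> a \<le> u i \<and> u i \<le> v i \<and> v i \<le> b"
    and disj: "disjoint_family_on (\<lambda>i. {u i<..<v i}) I"
  shows "(\<Sum>i\<in>I. f (v i) - f (u i)) \<le> f b - f a"
  using assms(2-)
proof (induction "card I" arbitrary: I b)
  case 0
  then show ?case using f by (auto simp: mono_def)
next
  case (Suc n)
  have split: "(\<Sum>i\<in>I. f (v i) - f (u i)) = (f (v i) - f (u i)) + (\<Sum>i\<in>I - {i}. f (v i) - f (u i))"
    if "i \<in> I" for i
    using Suc.prems(1) that by (simp add: sum.remove)
  have card: "n = card (I - {i})" if "i \<in> I" for i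
    using that Suc.hyps(2) Suc.prems(1) by simp
  have disj': "disjoint_family_on (\<lambda>i. {u i<..<v i}) (I - {i})" for i
    using Suc.prems(4) by (rule disjoint_family_on_mono[rotated]) auto
  show ?case
  \<comment> \<open>Degenerate intervals have empty interior, so disjointness does not say where
    they lie; they are removed before a rightmost interval is split off.\<close>
  proof (cases "\<exists>i\<in>I. u i = v i")
    case True
    then obtain i where i: "i \<in> I" "u i = v i" by blast
    have "(\<Sum>i\<in>I - {i}. f (v i) - f (u i)) \<le> f b - f a"
      using Suc.prems disj' by (intro Suc.hyps(1) card i) auto
    then show ?thesis using split[OF i(1)] i(2) by simp
  next
    case False
    have "I \<noteq> {}" using Suc.hyps(2) by auto
    then have "Max (v ` I) \<in> v ` I" using Suc.prems(1) by (intro Max_in) auto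
    then obtain i where i: "i \<in> I" and vi: "v i = Max (v ` I)" by auto
    have max: "v j \<le> v i" if "j \<in> I" for j
      using that Suc.prems(1) by (simp add: vi)
    have le: "v j \<le> u i" if j: "j \<in> I - {i}" for j
    proof (rule ccontr)
      assume "\<not> v j \<le> u i"
      moreover have "u i < v i" "u j < v j" using False Suc.prems(3) i j by (force simp: less_le)+
      ultimately have "(max (u i) (u j) + v j) / 2 \<in> {u i<..<v i} \<inter> {u j<..<v j}"
        using max[of j] j by (auto simp: max_def)
      then show False
        using disjoint_family_onD[OF Suc.prems(4), of i j] i j by auto
    qed
    \<comment> \<open>The other intervals end at or before \<open>u i\<close>, so the induction
      hypothesis applies with \<open>u i\<close> in the place of \<open>b\<close>.\<close>
    have "(\<Sum>i\<in>I - {i}. f (v i) - f (u i)) \<le> f (u i) - f a"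
      using Suc.prems disj' le i by (intro Suc.hyps(1) card) auto
    moreover have "f (v i) \<le> f b" using f Suc.prems(3) i by (auto simp: mono_def)
    ultimately show ?thesis using split[OF i] by simp
  qed
qed

text \<open>A closed interval is the closed ball around its midpoint, so Vitali's theorem for balls
  applies. The point \<open>x\<close> may be an endpoint, which lets one-sided slopes enter.\<close>

lemma Vitali_covering_intervals:
  fixes S :: "real set"
  assumes "\<And>x d. \<lbrakk>x \<in> S; 0 < d\<rbrakk> \<Longrightarrow> \<exists>u v. Q u v \<and> u \<le> x \<and> x \<le> v \<and> u < v \<and> v - u < d"
  obtains C where "countable C" "\<forall>i\<in>C. Q (fst i) (snd i) \<and> fst i < snd i"
    "disjoint_family_on (\<lambda>i. {fst i..snd i}) C"
    "negligible (S - (\<Union>i\<in>C. {fst i..snd i}))"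
proof -
  let ?K = "{i. Q (fst i) (snd i) \<and> fst i < snd i}"
  let ?a = "\<lambda>i::real\<times>real. (fst i + snd i) / 2" and ?r = "\<lambda>i::real\<times>real. (snd i - fst i) / 2"
  have cb: "cball (?a i) (?r i) = {fst i..snd i}" for i
    by (auto simp: cball_def dist_real_def abs_le_iff field_simps)
  have 1: "\<And>i. i \<in> ?K \<Longrightarrow> 0 < ?r i" by auto
  have 2: "\<exists>i. i \<in> ?K \<and> x \<in> cball (?a i) (?r i) \<and> ?r i < d" if x: "x \<in> S" and d: "0 < d" for x d
  proof -
    obtain u v where "Q u v \<and> u \<le> x \<and> x \<le> v \<and> u < v \<and> v - u < d" using assms[OF x d] by blast
    then show ?thesis unfolding cb by (intro exI[of _ "(u,v)"]) auto
  qed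
  obtain C where "countable C" "C \<subseteq> ?K"
     "pairwise (\<lambda>i j. disjnt (cball (?a i) (?r i)) (cball (?a j) (?r j))) C"
     "negligible(S - (\<Union>i \<in> C. cball (?a i) (?r i)))"
    using Vitali_covering_theorem_cballs[of ?K ?r S ?a, OF 1 2] by blast
  note C = this[unfolded cb]
  show thesis
  proof (rule that[OF C(1) _ _ C(4)])
    show "\<forall>i\<in>C. Q (fst i) (snd i) \<and> fst i < snd i" using C(2) by blast
    show "disjoint_family_on (\<lambda>i. {fst i..snd i}) C"
      using C(3) unfolding disjoint_family_on_def pairwise_def disjnt_def by blast
  qed
qed

text \<open>In a disjoint Vitali family of steep intervals, \<open>q\<close> times the total length
  is at most the total increase of \<open>f\<close>. A measurable superset is produced because
  \<open>S\<close> itself need not be measurable.\<close>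

lemma steep_slopes_cover:
  fixes f :: "real \<Rightarrow> real"
  assumes f: "mono f" and "a \<le> b" "q > 0" and S: "S \<subseteq> {a<..<b}"
    and slope: "\<And>x d. \<lbrakk>x \<in> S; 0 < d\<rbrakk> \<Longrightarrow>
      \<exists>u v. u \<le> x \<and> x \<le> v \<and> u < v \<and> v - u < d \<and> q * (v - u) < f v - f u"
  shows "\<exists>T\<in>lmeasurable. S \<subseteq> T \<and> measure lebesgue T \<le> (f b - f a) / q"
proof -
  have cov: "\<exists>u v. (a \<le> u \<and> v \<le> b \<and> q * (v - u) < f v - f u) \<and> u \<le> x \<and> x \<le> v \<and> u < v \<and> v - u < d"
    if x: "x \<in> S" and "0 < d" for x d
  proof -
    have "0 < min d (min (x - a) (b - x))" using x S \<open>0 < d\<close> by auto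
    from slope[OF x this] obtain u v where uv: "u \<le> x" "x \<le> v" "u < v"
      "v - u < min d (min (x - a) (b - x))" "q * (v - u) < f v - f u" by blast
    then have "a \<le> u" "v \<le> b" "v - u < d" by linarith+
    with uv show ?thesis by blast
  qed
  obtain C where C: "countable C"
      "\<forall>i\<in>C. (a \<le> fst i \<and> snd i \<le> b \<and> q * (snd i - fst i) < f (snd i) - f (fst i)) \<and> fst i < snd i"
    and disj: "disjoint_family_on (\<lambda>i. {fst i..snd i}) C"
    and neg: "negligible (S - (\<Union>i\<in>C. {fst i..snd i}))"
    by (rule Vitali_covering_intervals[where Q = "\<lambda>u v. a \<le> u \<and> v \<le> b \<and> q * (v - u) < f v - f u" and S = S, OF cov]) (assumption | rule that)+
  have B: "measure lebesgue (\<Union>i\<in>F. {fst i..snd i}) \<le> (f b - f a) / q"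
    if F: "F \<subseteq> C" "finite F" for F
  proof -
    have "measure lebesgue (\<Union>i\<in>F. {fst i..snd i}) \<le> (\<Sum>i\<in>F. measure lebesgue {fst i..snd i})"
      using F by (intro measure_UNION_le) auto
    also have "\<dots> \<le> (\<Sum>i\<in>F. (f (snd i) - f (fst i)) / q)"
      using F C(2) \<open>q > 0\<close> by (intro sum_mono) (force simp: pos_le_divide_eq algebra_simps)
    also have "\<dots> = (\<Sum>i\<in>F. (f (snd i) - f (fst i))) / q" by (simp add: sum_divide_distrib)
    also have "(\<Sum>i\<in>F. (f (snd i) - f (fst i))) \<le> f b - f a"
    proof (rule sum_disjoint_intervals_mono[OF f F(2) \<open>a \<le> b\<close>])
      show "disjoint_family_on (\<lambda>i. {fst i<..<snd i}) F"
        using disjoint_family_on_mono[OF F(1) disj]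
        by (rule disjoint_family_on_bisimulation) fastforce
    qed (use F C(2) in force)
    finally show ?thesis using \<open>q > 0\<close> by (simp add: divide_right_mono)
  qed
  let ?U = "\<Union>i\<in>C. {fst i..snd i}"
  have U: "?U \<in> lmeasurable" "measure lebesgue ?U \<le> (f b - f a) / q"
    using fmeasurable_UN_bound[OF C(1) _ B] measure_UN_bound[OF C(1) _ B] by auto
  let ?N = "S - ?U"
  have N: "?N \<in> lmeasurable" "measure lebesgue ?N = 0"
    using neg negligible_iff_measure by auto
  have "measure lebesgue (?U \<union> ?N) \<le> measure lebesgue ?U + measure lebesgue ?N"
    using U N by (intro measure_Un_le) auto
  moreover have "?U \<union> ?N \<in> lmeasurable" using U N by (intro fmeasurable.Un) auto
  ultimately show ?thesis using U N by (intro bexI[of _ "?U \<union> ?N"]) auto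
qed

text \<open>Disjoint shallow intervals inside \<open>U\<close> have total increase at most
  \<open>p\<close> times the measure of \<open>U\<close>. The cover uses open intervals because the
  steep cover is later built inside each of them.\<close>

lemma shallow_slopes_cover:
  fixes f :: "real \<Rightarrow> real"
  assumes U: "open U" "U \<in> lmeasurable" and "p > 0" and S: "S \<subseteq> U"
    and slope: "\<And>x d. \<lbrakk>x \<in> S; 0 < d\<rbrakk> \<Longrightarrow>
      \<exists>u v. u \<le> x \<and> x \<le> v \<and> u < v \<and> v - u < d \<and> f v - f u < p * (v - u)"
  obtains C where "countable C" "\<forall>i\<in>C. fst i < snd i"
    "negligible (S - (\<Union>i\<in>C. {fst i<..<snd i}))"
    "\<forall>F. finite F \<and> F \<subseteq> C \<longrightarrow> (\<Sum>i\<in>F. f (snd i) - f (fst i)) \<le> p * measure lebesgue U"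
proof -
  have cov: "\<exists>u v. ({u..v} \<subseteq> U \<and> f v - f u < p * (v - u)) \<and> u \<le> x \<and> x \<le> v \<and> u < v \<and> v - u < d"
    if x: "x \<in> S" and "0 < d" for x d
  proof -
    obtain e where e: "e > 0" "cball x e \<subseteq> U"
      using U(1) S x open_contains_cball by blast
    have "0 < min d e" using e \<open>0 < d\<close> by auto
    from slope[OF x this] obtain u v where uv: "u \<le> x" "x \<le> v" "u < v" "v - u < min d e" "f v - f u < p * (v - u)"
      by blast
    have "{u..v} \<subseteq> cball x e" using uv by (auto simp: dist_real_def)
    then show ?thesis using uv e by (intro exI[of _ u] exI[of _ v]) auto
  qed
  obtain C where C: "countable C"
      "\<forall>i\<in>C. ({fst i..snd i} \<subseteq> U \<and> f (snd i) - f (fst i) < p * (snd i - fst i)) \<and> fst i < snd i"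
    and disj: "disjoint_family_on (\<lambda>i. {fst i..snd i}) C"
    and neg: "negligible (S - (\<Union>i\<in>C. {fst i..snd i}))"
    by (rule Vitali_covering_intervals[where Q = "\<lambda>u v. {u..v} \<subseteq> U \<and> f v - f u < p * (v - u)" and S = S, OF cov]) (assumption | rule that)+
  \<comment> \<open>Passing from closed to open intervals loses only countably many
    endpoints.\<close>
  have "negligible (\<Union>i\<in>C. {fst i, snd i})"
    unfolding negligible_iff_null_sets using C(1)
    by (intro null_sets_completionI countable_imp_null_set_lborel countable_UN) auto
  then have "negligible ((S - (\<Union>i\<in>C. {fst i..snd i})) \<union> (\<Union>i\<in>C. {fst i, snd i}))"
    using neg by (rule negligible_Un[rotated])
  then have N: "negligible (S - (\<Union>i\<in>C. {fst i<..<snd i}))"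
    by (rule negligible_subset) (force simp: less_le)
  have "(\<Sum>i\<in>F. f (snd i) - f (fst i)) \<le> p * measure lebesgue U" if F: "finite F" "F \<subseteq> C" for F
  proof -
    have "(\<Sum>i\<in>F. f (snd i) - f (fst i)) \<le> (\<Sum>i\<in>F. p * measure lebesgue {fst i..snd i})"
      using F C(2) by (intro sum_mono) (force simp: less_imp_le)
    also have "\<dots> = p * (\<Sum>i\<in>F. measure lebesgue {fst i..snd i})" by (simp add: sum_distrib_left)
    also have "(\<Sum>i\<in>F. measure lebesgue {fst i..snd i}) = measure lebesgue (\<Union>i\<in>F. {fst i..snd i})"
      using F disjoint_family_on_mono[OF F(2) disj]
      by (intro measure_UNION'[symmetric]) (auto simp: disjoint_family_on_def pairwise_def disjnt_def)
    also have "\<dots> \<le> measure lebesgue U"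
    proof (rule measure_mono_fmeasurable)
      show "(\<Union>i\<in>F. {fst i..snd i}) \<subseteq> U" using F C(2) by blast
      show "(\<Union>i\<in>F. {fst i..snd i}) \<in> sets lebesgue" using F by (intro sets.finite_UN) auto
    qed (rule U)
    finally show ?thesis using \<open>p > 0\<close> by simp
  qed
  then show ?thesis using C(2) by (intro that[OF C(1) _ N]) simp_all
qed

text \<open>Cover \<open>S\<close> by shallow intervals and the part of \<open>S\<close> in each of
  them by steep ones: up to \<open>e\<close>, \<open>q\<close> times the outer measure of
  \<open>S\<close> is at most \<open>p\<close> times that measure, so it vanishes.\<close>

lemma negligible_shallow_and_steep:
  fixes f :: "real \<Rightarrow> real"
  assumes f: "mono f" and pq: "0 < p" "p < q" and S: "bounded S"
    and shallow: "\<And>x d. \<lbrakk>x \<in> S; 0 < d\<rbrakk> \<Longrightarrow>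
      \<exists>u v. u \<le> x \<and> x \<le> v \<and> u < v \<and> v - u < d \<and> f v - f u < p * (v - u)"
    and steep: "\<And>x d. \<lbrakk>x \<in> S; 0 < d\<rbrakk> \<Longrightarrow>
      \<exists>u v. u \<le> x \<and> x \<le> v \<and> u < v \<and> v - u < d \<and> q * (v - u) < f v - f u"
  shows "negligible S"
proof -
  \<comment> \<open>A measurable hull stands in for \<open>S\<close>: no Lebesgue measurable
    superset of \<open>S\<close> has smaller measure than \<open>T\<close>.\<close>
  obtain T where T: "T \<in> sets lebesgue" "S \<subseteq> T" "outer_measure_of lebesgue S = emeasure lebesgue T"
    using outer_measure_of_attain[of S lebesgue] by auto
  obtain a where a: "S \<subseteq> cbox (- a) a" using S bounded_subset_cbox_symmetric by blast
  have least: "emeasure lebesgue T \<le> emeasure lebesgue A" if "S \<subseteq> A" "A \<in> sets lebesgue" for A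
    using outer_measure_of_mono[OF that(1), of lebesgue] that(2) T(3) by simp
  have fm: "T \<in> lmeasurable"
  proof (rule fmeasurableI)
    show "emeasure lebesgue T < \<infinity>"
      using least[OF a] emeasure_bounded_finite[of "cbox (-a) a"] by (simp add: le_less_trans)
  qed (use T in auto)
  have least': "measure lebesgue T \<le> measure lebesgue A" if "S \<subseteq> A" "A \<in> lmeasurable" for A
    using least[OF that(1)] that(2) fm by (simp add: emeasure_eq_measure2 fmeasurableD)
  have "measure lebesgue T \<le> (p / q) * (measure lebesgue T + e)" if "e > 0" for e
  proof -
    obtain U where U: "open U" "T \<subseteq> U" "U - T \<in> lmeasurable" "emeasure lebesgue (U - T) < ennreal e"
      using sets_lebesgue_outer_open[OF T(1) \<open>e > 0\<close>] by blast
    have Ueq: "U = T \<union> (U - T)" using U(2) by auto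
    have Um: "U \<in> lmeasurable" by (subst Ueq) (intro fmeasurable.Un fm U(3))
    have "measure lebesgue (U - T) < e"
      using U(3,4) \<open>e > 0\<close> by (simp add: emeasure_eq_measure2 ennreal_less_iff)
    moreover have "measure lebesgue U \<le> measure lebesgue T + measure lebesgue (U - T)"
      by (subst Ueq) (intro measure_Un_le; use T U in auto)
    ultimately have mU: "measure lebesgue U \<le> measure lebesgue T + e" by simp
    have SU: "S \<subseteq> U" using T(2) U(2) by blast
    obtain C where C: "countable C" "\<forall>i\<in>C. fst i < snd i"
        "negligible (S - (\<Union>i\<in>C. {fst i<..<snd i}))"
        "\<forall>F. finite F \<and> F \<subseteq> C \<longrightarrow> (\<Sum>i\<in>F. f (snd i) - f (fst i)) \<le> p * measure lebesgue U"
      by (rule shallow_slopes_cover[OF U(1) Um pq(1) SU shallow]) (assumption | rule that)+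
    have "\<exists>T\<in>lmeasurable. S \<inter> {fst i<..<snd i} \<subseteq> T \<and> measure lebesgue T \<le> (f (snd i) - f (fst i)) / q"
      if "i \<in> C" for i
    proof (rule steep_slopes_cover[OF f])
      show "\<exists>u v. u \<le> x \<and> x \<le> v \<and> u < v \<and> v - u < d \<and> q * (v - u) < f v - f u"
        if "x \<in> S \<inter> {fst i<..<snd i}" "0 < d" for x d using steep that by blast
    qed (use C(2) that pq in \<open>auto simp: less_imp_le\<close>)
    then obtain A where A: "\<forall>i\<in>C. A i \<in> lmeasurable \<and> S \<inter> {fst i<..<snd i} \<subseteq> A i \<and>
        measure lebesgue (A i) \<le> (f (snd i) - f (fst i)) / q" by metis
    have B: "measure lebesgue (\<Union>i\<in>F. A i) \<le> p * measure lebesgue U / q" if F: "F \<subseteq> C" "finite F" for F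
    proof -
      have "measure lebesgue (\<Union>i\<in>F. A i) \<le> (\<Sum>i\<in>F. measure lebesgue (A i))"
        using F A by (intro measure_UNION_le) (auto simp: fmeasurableD)
      also have "\<dots> \<le> (\<Sum>i\<in>F. (f (snd i) - f (fst i)) / q)"
        using F A by (intro sum_mono) auto
      also have "\<dots> = (\<Sum>i\<in>F. (f (snd i) - f (fst i))) / q" by (simp add: sum_divide_distrib)
      also have "\<dots> \<le> p * measure lebesgue U / q"
        using C(4) F pq by (intro divide_right_mono) auto
      finally show ?thesis .
    qed
    let ?V = "\<Union>i\<in>C. A i" and ?N = "S - (\<Union>i\<in>C. {fst i<..<snd i})"
    have V: "?V \<in> lmeasurable" "measure lebesgue ?V \<le> p * measure lebesgue U / q"
      using fmeasurable_UN_bound[OF C(1) _ B] measure_UN_bound[OF C(1) _ B] A by auto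
    have N: "?N \<in> lmeasurable" "measure lebesgue ?N = 0"
      using C(3) negligible_iff_measure by auto
    have "measure lebesgue (?V \<union> ?N) \<le> measure lebesgue ?V + measure lebesgue ?N"
      using V N by (intro measure_Un_le) auto
    moreover have "measure lebesgue T \<le> measure lebesgue (?V \<union> ?N)"
    proof (rule least')
      show "S \<subseteq> ?V \<union> ?N" using A by blast
    qed (intro fmeasurable.Un V N)
    moreover have "p * measure lebesgue U / q \<le> (p / q) * (measure lebesgue T + e)"
      using mU pq by (simp add: divide_right_mono mult_left_mono)
    ultimately show ?thesis using V N by linarith
  qed
  then have "q * measure lebesgue T \<le> p * measure lebesgue T + p * e" if "e > 0" for e
    using pq that by (simp add: field_simps)
  then have "(q - p) / p * measure lebesgue T \<le> 0 + e" if "e > 0" for e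
    using pq that by (simp add: field_simps)
  then have "(q - p) / p * measure lebesgue T \<le> 0" by (rule field_le_epsilon)
  then have "measure lebesgue T \<le> 0" using pq by (simp add: zero_less_mult_iff divide_le_0_iff mult_le_0_iff)
  then have "measure lebesgue T = 0" using measure_nonneg[of lebesgue T] by linarith
  then have "negligible T" using fm by (simp add: negligible_iff_measure)
  then show ?thesis using T(2) negligible_subset by blast
qed

text \<open>Derivates are expressed through slopes over short intervals containing \<open>x\<close>.
  The sets \<open>A n p q\<close> catch the points where arbitrarily short slopes lie both below
  \<open>p\<close> and above \<open>q\<close>, the sets \<open>B n\<close> those with infinite upper
  derivate; elsewhere the slopes converge to a finite limit.\<close>

theorem mono_differentiable_AE:
  fixes f :: "real \<Rightarrow> real"
  assumes f: "mono f"
  shows "negligible {x. \<not> f differentiable (at x)}"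
proof -
  define steep where "steep q x \<longleftrightarrow> (\<forall>d>0. \<exists>u v. u \<le> x \<and> x \<le> v \<and> u < v \<and> v - u < d \<and>
    q * (v - u) < f v - f u)" for q x
  define shallow where "shallow p x \<longleftrightarrow> (\<forall>d>0. \<exists>u v. u \<le> x \<and> x \<le> v \<and> u < v \<and> v - u < d \<and>
    f v - f u < p * (v - u))" for p x
  define A where "A n p q = {x. \<bar>x\<bar> \<le> real n \<and> 0 < p \<and> p < q \<and> shallow p x \<and> steep q x}" for n p q
  define B where "B n = {x \<in> {- real n<..<real n}. \<forall>q>0. steep q x}" for n
  let ?N = "(\<Union>n. \<Union>p\<in>\<rat>. \<Union>q\<in>\<rat>. A n p q) \<union> (\<Union>n. B n)"
  have "negligible (A n p q)" for n p q
  proof (cases "0 < p \<and> p < q")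
    case True
    have "bounded (A n p q)" by (rule boundedI[of _ "real n"]) (auto simp: A_def)
    with True show ?thesis
    proof (intro negligible_shallow_and_steep[OF f, of p q])
      show "\<exists>u v. u \<le> x \<and> x \<le> v \<and> u < v \<and> v - u < d \<and> f v - f u < p * (v - u)"
        if "x \<in> A n p q" "0 < d" for x d
        using that unfolding A_def shallow_def by blast
      show "\<exists>u v. u \<le> x \<and> x \<le> v \<and> u < v \<and> v - u < d \<and> q * (v - u) < f v - f u"
        if "x \<in> A n p q" "0 < d" for x d
        using that unfolding A_def steep_def by blast
    qed auto
  next
    case False
    then have "A n p q = {}" by (auto simp: A_def)
    then show ?thesis by simp
  qed
  moreover have "negligible (B n)" for n
    unfolding negligible_outer_le
  proof (intro allI impI)
    fix e :: real assume "e > 0"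
    let ?D = "f (real n) - f (- real n)"
    have D: "?D \<ge> 0" using f by (simp add: mono_def)
    \<comment> \<open>This makes \<open>?D / q\<close> at most \<open>e\<close>; the summand 1 keeps
      \<open>q\<close> positive when \<open>?D\<close> is 0.\<close>
    define q where "q = ?D / e + 1"
    have q: "q > 0" using D \<open>e > 0\<close> by (simp add: q_def add_nonneg_pos)
    have "\<exists>T\<in>lmeasurable. B n \<subseteq> T \<and> measure lebesgue T \<le> ?D / q"
    proof (rule steep_slopes_cover[OF f _ q])
      show "\<exists>u v. u \<le> x \<and> x \<le> v \<and> u < v \<and> v - u < d \<and> q * (v - u) < f v - f u"
        if "x \<in> B n" "0 < d" for x d
        using that q unfolding B_def steep_def by blast
    qed (auto simp: B_def)
    then obtain T where "T \<in> lmeasurable" "B n \<subseteq> T" "measure lebesgue T \<le> ?D / q" by blast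
    moreover have "e * q = ?D + e" using \<open>e > 0\<close> by (simp add: q_def distrib_left)
    then have "?D / q \<le> e" using q \<open>e > 0\<close> by (simp add: pos_divide_le_eq)
    ultimately show "\<exists>T. B n \<subseteq> T \<and> T \<in> lmeasurable \<and> measure lebesgue T \<le> e"
      by (meson order_trans)
  qed
  ultimately have N: "negligible ?N"
    unfolding negligible_iff_null_sets
    by (intro null_sets.Un null_sets_UN' countable_rat) auto
  have "f differentiable (at x)" if x: "x \<notin> ?N" for x
  proof -
    have nshallow: "\<not> shallow p x" if "0 < p" "p < q" "steep q x" "p \<in> \<rat>" "q \<in> \<rat>" for p q
    proof
      assume "shallow p x"
      then have "x \<in> A (nat \<lceil>\<bar>x\<bar>\<rceil>) p q" using that by (auto simp: A_def real_nat_ceiling_ge)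
      with x that show False by auto
    qed
    have "\<exists>q>0. \<not> steep q x"
    proof (rule ccontr)
      assume "\<not> ?thesis"
      moreover obtain n where "\<bar>x\<bar> < real n" using reals_Archimedean2 by blast
      ultimately have "x \<in> B n" by (auto simp: B_def)
      with x show False by blast
    qed
    \<comment> \<open>This is the upper derivate: every positive number below \<open>L\<close> is
      exceeded by arbitrarily short slopes.\<close>
    define L where "L = Inf {q. 0 < q \<and> \<not> steep q x}"
    have bdd: "bdd_below {q. 0 < q \<and> \<not> steep q x}" by (rule bdd_belowI[of _ 0]) auto
    have "((\<lambda>y. (f y - f x) / (y - x)) \<longlongrightarrow> L) (at x)"
      unfolding tendsto_iff
    proof (intro allI impI)
      fix e :: real assume "e > 0"
      obtain q where q: "0 < q" "\<not> steep q x" "q < L + e"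
        using cInf_lessD[of "{q. 0 < q \<and> \<not> steep q x}" "L + e"] \<open>\<exists>q>0. \<not> steep q x\<close> \<open>e > 0\<close>
        by (auto simp: L_def)
      obtain d1 where d1: "d1 > 0" "\<And>u v. u \<le> x \<Longrightarrow> x \<le> v \<Longrightarrow> u < v \<Longrightarrow> v - u < d1 \<Longrightarrow> f v - f u \<le> q * (v - u)"
        using q(2) unfolding steep_def by (meson not_less)
      have "\<exists>d2>0. \<exists>p>L - e. \<forall>u v. u \<le> x \<longrightarrow> x \<le> v \<longrightarrow> u < v \<longrightarrow> v - u < d2 \<longrightarrow> p * (v - u) \<le> f v - f u"
      \<comment> \<open>For negative \<open>L - e\<close>, monotonicity gives the lower slope bound
        0. Otherwise take rationals \<open>p < q'\<close> between \<open>L - e\<close> and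
        \<open>L\<close>: \<open>x\<close> is steep for \<open>q'\<close>, hence not shallow for
        \<open>p\<close>.\<close>
      proof (cases "L - e < 0")
        case True
        then show ?thesis using f by (intro exI[of _ 1] conjI exI[of _ 0]) (auto simp: mono_def)
      next
        case False
        obtain p where p: "p \<in> \<rat>" "L - e < p" "p < L" using Rats_dense_in_real[of "L - e" L] \<open>e > 0\<close> by auto
        obtain q' where q': "q' \<in> \<rat>" "p < q'" "q' < L" using Rats_dense_in_real[of p L] p by auto
        have "steep q' x"
          using cInf_lower[OF _ bdd, of q'] q' p False by (fastforce simp: L_def)
        then have "\<not> shallow p x" using p q' False by (intro nshallow[of p q']) auto
        then show ?thesis using p unfolding shallow_def by (meson not_less)
      qed
      then obtain d2 p where d2: "d2 > 0" "p > L - e" 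
        "\<And>u v. u \<le> x \<Longrightarrow> x \<le> v \<Longrightarrow> u < v \<Longrightarrow> v - u < d2 \<Longrightarrow> p * (v - u) \<le> f v - f u" by blast
      have "dist ((f y - f x) / (y - x)) L < e" if y: "y \<noteq> x" "dist y x < min d1 d2" for y
      proof -
        have "p \<le> (f y - f x) / (y - x) \<and> (f y - f x) / (y - x) \<le> q"
        proof (cases "x < y")
          case True
          then show ?thesis using d1(2)[of x y] d2(3)[of x y] y by (simp add: dist_real_def field_simps)
        next
          case False
          then have "(f y - f x) / (y - x) = (f x - f y) / (x - y)"
            by (metis minus_diff_eq minus_divide_divide)
          with False show ?thesis using d1(2)[of y x] d2(3)[of y x] y
            by (simp add: dist_real_def field_simps)
        qed
        with q d2 show ?thesis by (auto simp: dist_real_def abs_less_iff)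
      qed
      then show "\<forall>\<^sub>F y in at x. dist ((f y - f x) / (y - x)) L < e"
        unfolding eventually_at using d1(1) d2(1) by (intro exI[of _ "min d1 d2"]) auto
    qed
    then show ?thesis
      by (metis has_field_derivative_iff real_differentiable_def)
  qed
  then have "{x. \<not> f differentiable (at x)} \<subseteq> ?N" by blast
  with N show ?thesis by (rule negligible_subset)
qed

section \<open>Absolutely continuous functions\<close>

text \<open>A change of index set: later the intervals are indexed by the tagged tiles of a division
  and by a one-element type.\<close>

lemma abs_cont_onD_finite:
  assumes "abs_cont_on a b f" "e > 0"
  obtains d where "d > 0" "\<forall>I u v. finite (I :: 'i set) \<longrightarrow> (\<forall>i\<in>I. a \<le> u i \<and> u i \<le> v i \<and> v i \<le> b) \<longrightarrow>
    disjoint_family_on (\<lambda>i. {u i<..<v i}) I \<longrightarrow> (\<Sum>i\<in>I. v i - u i) < d \<longrightarrow>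
    (\<Sum>i\<in>I. \<bar>f (v i) - f (u i)\<bar>) < e"
proof -
  from assms(1)[unfolded abs_cont_on_def, rule_format, OF assms(2)]
  obtain d where d: "d > 0" and *: "\<forall>(n::nat) u v. (\<forall>i<n. a \<le> u i \<and> u i \<le> v i \<and> v i \<le> b) \<and>
      disjoint_family_on (\<lambda>i. {u i<..<v i}) {..<n} \<and> (\<Sum>i<n. v i - u i) < d
      \<longrightarrow> (\<Sum>i<n. \<bar>f (v i) - f (u i)\<bar>) < e"
    by (elim exE conjE) (rule that, assumption+)
  show thesis
  proof (rule that[OF d], intro allI impI)
    fix I :: "'i set" and u v :: "'i \<Rightarrow> real"
    assume I: "finite I" "\<forall>i\<in>I. a \<le> u i \<and> u i \<le> v i \<and> v i \<le> b"
      and disj: "disjoint_family_on (\<lambda>i. {u i<..<v i}) I" and sum: "(\<Sum>i\<in>I. v i - u i) < d"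
    obtain h where h: "bij_betw h {..<card I} I"
      using ex_bij_betw_nat_finite[OF I(1)] by (auto simp: atLeast0LessThan)
    have re: "(\<Sum>i<card I. g (h i)) = (\<Sum>i\<in>I. g i)" for g :: "'i \<Rightarrow> real"
      by (rule sum.reindex_bij_betw[OF h])
    have hI: "h i \<in> I" if "i < card I" for i
      using h that by (auto simp: bij_betw_def)
    have "(\<Sum>i<card I. \<bar>f (v (h i)) - f (u (h i))\<bar>) < e"
    proof (rule *[rule_format], intro conjI)
      show "\<forall>i<card I. a \<le> u (h i) \<and> u (h i) \<le> v (h i) \<and> v (h i) \<le> b" using I hI by blast
      show "disjoint_family_on (\<lambda>i. {u (h i)<..<v (h i)}) {..<card I}"
        unfolding disjoint_family_on_def
      proof (intro ballI impI)
        fix m n assume mn: "m \<in> {..<card I}" "n \<in> {..<card I}" "m \<noteq> n"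
        then have "h m \<noteq> h n" using h by (auto simp: bij_betw_def inj_on_def)
        then show "{u (h m)<..<v (h m)} \<inter> {u (h n)<..<v (h n)} = {}"
          using disjoint_family_onD[OF disj, of "h m" "h n"] hI mn by simp
      qed
      show "(\<Sum>i<card I. v (h i) - u (h i)) < d"
        using sum re[of "\<lambda>i. v i - u i"] by simp
    qed
    then show "(\<Sum>i\<in>I. \<bar>f (v i) - f (u i)\<bar>) < e"
      using re[of "\<lambda>i. \<bar>f (v i) - f (u i)\<bar>"] by simp
  qed
qed

lemma sum_disjoint_intervals_le_measure:
  fixes u v :: "'i \<Rightarrow> real"
  assumes "finite I" and I: "\<And>i. i \<in> I \<Longrightarrow> u i \<le> v i \<and> {u i<..<v i} \<subseteq> U" and U: "U \<in> lmeasurable"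
    and disj: "disjoint_family_on (\<lambda>i. {u i<..<v i}) I"
  shows "(\<Sum>i\<in>I. v i - u i) \<le> measure lebesgue U"
proof -
  have "(\<Sum>i\<in>I. v i - u i) = (\<Sum>i\<in>I. measure lebesgue {u i<..<v i})"
    using I by (intro sum.cong) auto
  also have "\<dots> = measure lebesgue (\<Union>i\<in>I. {u i<..<v i})"
    using assms(1) disj
    by (intro measure_UNION'[symmetric]) (auto simp: disjoint_family_on_def pairwise_def disjnt_def)
  also have "\<dots> \<le> measure lebesgue U"
  proof (rule measure_mono_fmeasurable)
    show "(\<Union>i\<in>I. {u i<..<v i}) \<subseteq> U" using I by blast
    show "(\<Union>i\<in>I. {u i<..<v i}) \<in> sets lebesgue" using assms(1) by (intro sets.finite_UN) auto
  qed (rule U)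
  finally show ?thesis .
qed

text \<open>A gauge that is controlled by differentiability off \<open>N\<close> and lies in an open set of small measure
  on \<open>N\<close>: absolute continuity bounds the contribution of the tags in \<open>N\<close>.\<close>

theorem abs_cont_has_integral:
  fixes f g :: "real \<Rightarrow> real"
  assumes ac: "abs_cont_on a b f" and ab: "a \<le> b" and N: "negligible N"
    and deriv: "\<And>x. x \<in> {a..b} - N \<Longrightarrow> (f has_real_derivative g x) (at x)"
  shows "(g has_integral (f b - f a)) {a..b}"
proof -
  \<comment> \<open>With value 0 on \<open>N\<close>, a tag in \<open>N\<close> contributes nothing
    but an increment of \<open>f\<close>, which absolute continuity controls.\<close>
  define g0 where "g0 x = (if x \<in> N then 0 else g x)" for x
  have "(g0 has_integral (f b - f a)) {a..b}"
    unfolding has_integral_real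
  proof (intro allI impI)
    fix e :: real assume e: "e > 0"
    obtain d where d: "d > 0" and acd: "\<forall>I u v. finite (I :: (real \<times> real set) set) \<longrightarrow>
      (\<forall>i\<in>I. a \<le> u i \<and> u i \<le> v i \<and> v i \<le> b) \<longrightarrow>
      disjoint_family_on (\<lambda>i. {u i<..<v i}) I \<longrightarrow> (\<Sum>i\<in>I. v i - u i) < d \<longrightarrow>
      (\<Sum>i\<in>I. \<bar>f (v i) - f (u i)\<bar>) < e / 2"
      using abs_cont_onD_finite[OF ac, of "e / 2"] e by auto
    obtain U where U: "open U" "N \<subseteq> U" "U - N \<in> lmeasurable" "emeasure lebesgue (U - N) < ennreal d"
      using sets_lebesgue_outer_open[of N d] N d negligible_imp_sets by blast
    have Ueq: "U = N \<union> (U - N)" using U(2) by auto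
    have Nm: "N \<in> lmeasurable" "measure lebesgue N = 0" using N negligible_iff_measure by auto
    have Um: "U \<in> lmeasurable" by (subst Ueq) (intro fmeasurable.Un Nm U(3))
    have "measure lebesgue (U - N) < d"
      using U(3,4) d by (simp add: emeasure_eq_measure2 ennreal_less_iff)
    moreover have "measure lebesgue U \<le> measure lebesgue N + measure lebesgue (U - N)"
      by (subst Ueq) (intro measure_Un_le; use Nm U in auto)
    ultimately have mU: "measure lebesgue U < d" using Nm by simp
    define c where "c = e / (2 * (b - a + 1))"
    have c: "c > 0" using e ab by (simp add: c_def)
    have "\<exists>r>0. \<forall>y. \<bar>y - x\<bar> < r \<longrightarrow> \<bar>f y - f x - g x * (y - x)\<bar> \<le> c * \<bar>y - x\<bar>"
      if "x \<in> {a..b} - N" for x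
      using deriv[OF that] c
      unfolding has_field_derivative_def has_derivative_at_alt by (auto simp: mult.commute)
    then obtain r where r: "\<And>x. x \<in> {a..b} - N \<Longrightarrow> r x > 0"
      "\<And>x y. x \<in> {a..b} - N \<Longrightarrow> \<bar>y - x\<bar> < r x \<Longrightarrow> \<bar>f y - f x - g x * (y - x)\<bar> \<le> c * \<bar>y - x\<bar>" by metis
    define \<gamma> where "\<gamma> x = (if x \<in> N then U else if x \<in> {a..b} then ball x (r x) else UNIV)" for x
    have gauge: "gauge \<gamma>"
      unfolding gauge_def \<gamma>_def using U r(1) by auto
    have fine: "norm ((\<Sum>(x,k)\<in>D. measure lborel k *\<^sub>R g0 x) - (f b - f a)) < e"
      if D: "D tagged_division_of {a..b}" "\<gamma> fine D" for D
    proof -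
      have fin: "finite D" using D(1) by blast
      have k: "\<exists>u v. a \<le> u \<and> u \<le> x \<and> x \<le> v \<and> v \<le> b \<and> k = {u..v} \<and> k \<subseteq> \<gamma> x" if xk: "(x, k) \<in> D" for x k
      proof -
        have "x \<in> k" "k \<subseteq> {a..b}" "k \<subseteq> \<gamma> x" using tagged_division_ofD(2-4)[OF D(1) xk] fineD[OF D(2) xk] by auto
        moreover obtain u v where "k = {u..v}" using tagged_division_ofD(4)[OF D(1) xk] by auto
        ultimately show ?thesis by (intro exI[of _ u] exI[of _ v]) auto
      qed
      define t where "t i = measure lborel (snd i) * g0 (fst i) - (f (Sup (snd i)) - f (Inf (snd i)))" for i :: "real \<times> real set"
      define DN where "DN = {i \<in> D. fst i \<in> N}"
      have "(\<Sum>(x,k)\<in>D. measure lborel k *\<^sub>R g0 x) - (f b - f a) = (\<Sum>i\<in>D. t i)"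
        unfolding additive_tagged_division_1[OF ab D(1), of f, symmetric]
        by (simp add: t_def split_beta sum_subtractf)
      also have "\<dots> = (\<Sum>i\<in>DN. t i) + (\<Sum>i\<in>D - DN. t i)"
        using fin by (subst sum.subset_diff[of DN D]) (auto simp: DN_def)
      finally have eq: "(\<Sum>(x,k)\<in>D. measure lborel k *\<^sub>R g0 x) - (f b - f a) = (\<Sum>i\<in>DN. t i) + (\<Sum>i\<in>D - DN. t i)" .
      have "\<bar>\<Sum>i\<in>DN. t i\<bar> \<le> (\<Sum>i\<in>DN. \<bar>f (Sup (snd i)) - f (Inf (snd i))\<bar>)"
        by (rule order_trans[OF sum_abs]) (auto intro!: sum_mono simp: t_def DN_def g0_def)
      also have "\<dots> < e / 2"
      proof (rule acd[rule_format])
        show fDN: "finite DN" using fin by (simp add: DN_def)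
        show ends: "a \<le> Inf (snd i) \<and> Inf (snd i) \<le> Sup (snd i) \<and> Sup (snd i) \<le> b" if "i \<in> DN" for i
          using k[of "fst i" "snd i"] that by (auto simp: DN_def)
        show disj: "disjoint_family_on (\<lambda>i. {Inf (snd i)<..<Sup (snd i)}) DN"
          unfolding disjoint_family_on_def
        proof (intro ballI impI)
          fix i j assume ij: "i \<in> DN" "j \<in> DN" "i \<noteq> j"
          have *: "interior (snd i) = {Inf (snd i)<..<Sup (snd i)}" if "i \<in> DN" for i
            using k[of "fst i" "snd i"] that by (auto simp: DN_def)
          have "interior (snd i) \<inter> interior (snd j) = {}"
            using tagged_division_ofD(5)[OF D(1), of "fst i" "snd i" "fst j" "snd j"] ij
            by (auto simp: DN_def prod_eq_iff)
          then show "{Inf (snd i)<..<Sup (snd i)} \<inter> {Inf (snd j)<..<Sup (snd j)} = {}"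
            using * ij by simp
        qed
        have "(\<Sum>i\<in>DN. Sup (snd i) - Inf (snd i)) \<le> measure lebesgue U"
        proof (rule sum_disjoint_intervals_le_measure[OF fDN _ Um disj])
          fix i assume i: "i \<in> DN"
          then have "\<gamma> (fst i) = U" by (simp add: DN_def \<gamma>_def)
          then show "Inf (snd i) \<le> Sup (snd i) \<and> {Inf (snd i)<..<Sup (snd i)} \<subseteq> U"
            using k[of "fst i" "snd i"] i by (auto simp: DN_def subset_iff)
        qed
        with mU show "(\<Sum>i\<in>DN. Sup (snd i) - Inf (snd i)) < d" by simp
      qed
      finally have 1: "\<bar>\<Sum>i\<in>DN. t i\<bar> < e / 2" .
      have "\<bar>t i\<bar> \<le> c * measure lborel (snd i)" if i: "i \<in> D - DN" for i
      proof -
        let ?x = "fst i"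
        obtain u v where uv: "a \<le> u" "u \<le> ?x" "?x \<le> v" "v \<le> b" "snd i = {u..v}" "snd i \<subseteq> \<gamma> ?x"
          using k[of ?x "snd i"] i by (auto simp: DN_def)
        have x: "?x \<in> {a..b} - N" using uv i by (auto simp: DN_def)
        then have "{u..v} \<subseteq> ball ?x (r ?x)" using uv by (auto simp: \<gamma>_def)
        moreover have "u \<in> {u..v}" "v \<in> {u..v}" using uv by auto
        ultimately have "u \<in> ball ?x (r ?x)" "v \<in> ball ?x (r ?x)" by blast+
        then have "\<bar>u - ?x\<bar> < r ?x" "\<bar>v - ?x\<bar> < r ?x" by (auto simp: dist_real_def)
        then have "\<bar>f u - f ?x - g ?x * (u - ?x)\<bar> \<le> c * (?x - u)" "\<bar>f v - f ?x - g ?x * (v - ?x)\<bar> \<le> c * (v - ?x)"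
          using r(2)[OF x, of u] r(2)[OF x, of v] uv by auto
        \<comment> \<open>The tag lies between the ends of its tile, so the two first-order errors
          add up to \<open>c\<close> times the length of the tile.\<close>
        then have "\<bar>(f u - f ?x - g ?x * (u - ?x)) - (f v - f ?x - g ?x * (v - ?x))\<bar> \<le> c * (?x - u) + c * (v - ?x)"
          by linarith
        then show ?thesis using uv x by (simp add: t_def g0_def algebra_simps)
      qed
      then have "\<bar>\<Sum>i\<in>D - DN. t i\<bar> \<le> (\<Sum>i\<in>D - DN. c * measure lborel (snd i))"
        by (intro order_trans[OF sum_abs] sum_mono)
      also have "\<dots> \<le> (\<Sum>i\<in>D. c * measure lborel (snd i))"
        using c fin by (intro sum_mono2) auto
      also have "\<dots> = c * (b - a)"
        using additive_content_tagged_division[of D a b] D(1) ab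
        by (simp add: sum_distrib_left[symmetric] split_beta)
      also have "\<dots> < e / 2" using e ab by (simp add: c_def field_simps)
      finally have 2: "\<bar>\<Sum>i\<in>D - DN. t i\<bar> < e / 2" .
      show ?thesis unfolding eq using 1 2 by simp
    qed
    show "\<exists>\<gamma>. gauge \<gamma> \<and> (\<forall>D. D tagged_division_of {a..b} \<and> \<gamma> fine D \<longrightarrow>
        norm ((\<Sum>(x,k)\<in>D. measure lborel k *\<^sub>R g0 x) - (f b - f a)) < e)"
      using fine by (intro exI[of _ \<gamma>] conjI gauge allI impI) simp
  qed
  then show ?thesis
    by (rule has_integral_spike[OF N, rotated]) (simp add: g0_def)
qed

text \<open>The next two lemmas replace the inequalities of Hoelder and Young. Optimising over the scale \<open>M\<close>
  costs only the factor \<open>2 powr p\<close>.\<close>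

lemma powr_le_if_all_scales:
  fixes D h I p :: real
  assumes p: "p > 1" and "D \<ge> 0" "h > 0" "I \<ge> 0"
    and bound: "\<And>M. M > 0 \<Longrightarrow> D \<le> M * h + M powr (1 - p) * I"
  shows "D powr p \<le> 2 powr p * (I * h powr (p - 1))"
proof (cases "I = 0")
  case True
  have "D \<le> 0 + e" if "e > 0" for e
    using bound[of "e / h"] that \<open>h > 0\<close> True by simp
  then have "D \<le> 0" by (rule field_le_epsilon)
  then show ?thesis using assms True by simp
next
  case False
  then have I: "I > 0" using assms by simp
  \<comment> \<open>The scale at which the two terms of the bound are equal.\<close>
  define M where "M = (I / h) powr (1 / p)"
  have M: "M > 0" using I assms by (simp add: M_def)
  have "M powr p = I / h" using I assms by (simp add: M_def powr_powr)
  then have "M powr (1 - p) * I = M * h"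
    using M I assms by (simp add: powr_diff field_simps)
  then have "D \<le> 2 * (M * h)" using bound[OF M] by simp
  then have "D powr p \<le> (2 * (M * h)) powr p" using assms by (intro powr_mono2) auto
  also have "\<dots> = 2 powr p * (M powr p * h powr p)"
    using M assms by (simp add: powr_mult)
  also have "M powr p * h powr p = I * h powr (p - 1)"
    using \<open>M powr p = I / h\<close> assms by (simp add: powr_diff)
  finally show ?thesis .
qed

lemma le_all_scales_if_powr_le:
  fixes D h I p M :: real
  assumes p: "p > 1" and "D \<ge> 0" "h > 0" "I \<ge> 0" "M > 0"
    and le: "D powr p \<le> I * h powr (p - 1)"
  shows "D \<le> M * h + M powr (1 - p) * I"
proof (cases "D \<le> M * h")
  case True
  have "0 \<le> M powr (1 - p) * I" using assms by simp
  with True show ?thesis by linarith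
next
  case False
  then have D: "D > 0" "h < D / M" using assms by (auto simp: field_simps not_le intro: less_trans[rotated])
  \<comment> \<open>Replacing \<open>h\<close> by the larger \<open>D / M\<close> and cancelling
    \<open>D powr (p - 1)\<close> shows that the second term alone bounds \<open>D\<close>.\<close>
  have "D * D powr (p - 1) = D powr p" using D by (simp add: powr_diff)
  also have "\<dots> \<le> I * (D / M) powr (p - 1)"
    using D assms by (intro order_trans[OF le] mult_left_mono powr_mono2) auto
  also have "\<dots> = M powr (1 - p) * I * D powr (p - 1)"
    using D assms by (simp add: powr_divide powr_diff)
  finally have "D \<le> M powr (1 - p) * I" using D by simp
  moreover have "0 \<le> M * h" using assms by simp
  ultimately show ?thesis by linarith
qed

section \<open>Increments dominated by a bounded monotone function\<close>

text \<open>\<open>W\<close> may jump, so short intervals need not have small increments of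
  \<open>W\<close>. Instead \<open>M\<close> is first taken so large that the whole increase of
  \<open>W\<close> on the interval costs less than \<open>e / 2\<close>, possible since
  \<open>M powr (1 - p)\<close> tends to 0; the total length is restricted afterwards.\<close>

lemma Riesz_abs_cont:
  fixes G W :: "real \<Rightarrow> real"
  assumes p: "p > 1" and W: "mono W"
    and le: "\<And>x y. x < y \<Longrightarrow> \<bar>G y - G x\<bar> powr p \<le> (W y - W x) * (y - x) powr (p - 1)"
  shows "locally_abs_cont G"
  unfolding locally_abs_cont_def abs_cont_on_def
proof (intro allI impI)
  fix a b e :: real assume ab: "a \<le> b" and e: "e > 0"
  define D where "D = W b - W a + 1"
  have D: "D > 0" using W ab by (simp add: D_def mono_def add_nonneg_pos)
  define M where "M = (2 * D / e) powr (1 / (p - 1))"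
  have M: "M > 0" using D e by (simp add: M_def)
  have "M powr (p - 1) = 2 * D / e" using D e p by (simp add: M_def powr_powr)
  then have "M powr (1 - p) = e / (2 * D)"
    using M D e by (simp add: powr_minus_divide[of M "p - 1", simplified])
  have MD: "M powr (1 - p) * (W b - W a) < e / 2"
    unfolding \<open>M powr (1 - p) = _\<close> using D e by (simp add: D_def field_simps)
  show "\<exists>\<delta>>0. \<forall>n u v. (\<forall>i<n. a \<le> u i \<and> u i \<le> v i \<and> v i \<le> b) \<and>
      disjoint_family_on (\<lambda>i. {u i<..<v i}) {..<n::nat} \<and> (\<Sum>i<n. v i - u i) < \<delta> \<longrightarrow>
      (\<Sum>i<n. \<bar>G (v i) - G (u i)\<bar>) < e"
  proof (intro exI[of _ "e / (2 * M)"] conjI allI impI; (elim conjE)?)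
    show "e / (2 * M) > 0" using e M by simp
    fix n :: nat and u v :: "nat \<Rightarrow> real"
    assume I: "\<forall>i<n. a \<le> u i \<and> u i \<le> v i \<and> v i \<le> b"
      and disj: "disjoint_family_on (\<lambda>i. {u i<..<v i}) {..<n}" and sum: "(\<Sum>i<n. v i - u i) < e / (2 * M)"
    have "(\<Sum>i<n. \<bar>G (v i) - G (u i)\<bar>) \<le> (\<Sum>i<n. M * (v i - u i) + M powr (1 - p) * (W (v i) - W (u i)))"
    proof (rule sum_mono)
      fix i assume "i \<in> {..<n}"
      then have "u i \<le> v i" using I by simp
      show "\<bar>G (v i) - G (u i)\<bar> \<le> M * (v i - u i) + M powr (1 - p) * (W (v i) - W (u i))"
      proof (cases "u i = v i")
        case False
        then have "u i < v i" using \<open>u i \<le> v i\<close> by simp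
        then show ?thesis
          using W M by (intro le_all_scales_if_powr_le[OF p] le) (auto simp: mono_def)
      qed simp
    qed
    also have "\<dots> = M * (\<Sum>i<n. v i - u i) + M powr (1 - p) * (\<Sum>i<n. W (v i) - W (u i))"
      by (simp add: sum.distrib sum_distrib_left)
    also have "\<dots> \<le> M * (\<Sum>i<n. v i - u i) + M powr (1 - p) * (W b - W a)"
      using sum_disjoint_intervals_mono[OF W _ ab _ disj] I
      by (intro add_left_mono mult_left_mono) auto
    also have "M * (\<Sum>i<n. v i - u i) < e / 2" using sum M by (simp add: field_simps)
    finally show "(\<Sum>i<n. \<bar>G (v i) - G (u i)\<bar>) < e" using MD by linarith
  qed
qed

lemma Riesz_continuous:
  fixes G W :: "real \<Rightarrow> real"
  assumes p: "p > 1" and W: "mono W"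
    and le: "\<And>x y. x < y \<Longrightarrow> \<bar>G y - G x\<bar> powr p \<le> (W y - W x) * (y - x) powr (p - 1)"
  shows "continuous_on UNIV G"
  unfolding continuous_on_iff
proof (intro ballI allI impI)
  fix x e :: real assume e: "e > 0"
  from Riesz_abs_cont[OF p W le] have "abs_cont_on (x - 1) (x + 1) G" by (simp add: locally_abs_cont_def)
  then obtain d where d: "d > 0" and *: "\<forall>I u v. finite (I :: unit set) \<longrightarrow>
      (\<forall>i\<in>I. x - 1 \<le> u i \<and> u i \<le> v i \<and> v i \<le> x + 1) \<longrightarrow>
      disjoint_family_on (\<lambda>i. {u i<..<v i}) I \<longrightarrow> (\<Sum>i\<in>I. v i - u i) < d \<longrightarrow>
      (\<Sum>i\<in>I. \<bar>G (v i) - G (u i)\<bar>) < e"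
    using e by (rule abs_cont_onD_finite)
  have "dist (G y) (G x) < e" if y: "dist y x < min d 1" for y
  proof (cases "x \<le> y")
    case True
    then show ?thesis using *[rule_format, of UNIV "\<lambda>_. x" "\<lambda>_. y"] y
      by (auto simp: dist_real_def disjoint_family_on_def UNIV_unit)
  next
    case False
    then show ?thesis using *[rule_format, of UNIV "\<lambda>_. y" "\<lambda>_. x"] y
      by (auto simp: dist_real_def disjoint_family_on_def UNIV_unit)
  qed
  then show "\<exists>d>0. \<forall>x'\<in>UNIV. dist x' x < d \<longrightarrow> dist (G x') (G x) < e"
    using d by (intro exI[of _ "min d 1"]) auto
qed

lemma Riesz_differentiable_AE:
  fixes G W :: "real \<Rightarrow> real"
  assumes p: "p > 1" and W: "mono W"
    and le: "\<And>x y. x < y \<Longrightarrow> \<bar>G y - G x\<bar> powr p \<le> (W y - W x) * (y - x) powr (p - 1)"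
  shows "negligible {x. \<not> G differentiable (at x)}"
proof -
  let ?B = "\<lambda>x. W x + x" and ?A = "\<lambda>x. G x + (W x + x)"
  \<comment> \<open>At scale 1 the power bound becomes linear, which is what makes \<open>?A\<close>
    monotone.\<close>
  have le1: "\<bar>G y - G x\<bar> \<le> (y - x) + (W y - W x)" if "x < y" for x y
    using le_all_scales_if_powr_le[OF p _ _ _ _ le[OF that], of 1] that W by (simp add: mono_def)
  have "mono ?B" using W by (auto simp: mono_def intro: add_mono)
  moreover have "mono ?A"
  proof (rule monoI)
    fix x y :: real assume "x \<le> y"
    then show "?A x \<le> ?A y" using le1[of x y] by (cases "x = y") auto
  qed
  ultimately have "negligible ({x. \<not> ?A differentiable (at x)} \<union> {x. \<not> ?B differentiable (at x)})"
    by (intro negligible_Un mono_differentiable_AE)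
  moreover have "G differentiable (at x)" if "?A differentiable (at x)" "?B differentiable (at x)" for x
    using differentiable_diff[OF that] by simp
  then have "{x. \<not> G differentiable (at x)} \<subseteq> {x. \<not> ?A differentiable (at x)} \<union> {x. \<not> ?B differentiable (at x)}"
    by blast
  ultimately show ?thesis by (rule negligible_subset)
qed

text \<open>The integral telescopes to that of \<open>W\<close> over \<open>{R..R + h}\<close> minus
  that over \<open>{-R..-R + h}\<close>, so the bound does not involve \<open>R\<close>.\<close>

lemma mono_shift_integral_bound:
  fixes W :: "real \<Rightarrow> real"
  assumes W: "mono W" and range: "\<And>x. 0 \<le> W x \<and> W x \<le> V" and h: "h > 0" and "R \<ge> 0"
  shows "(\<integral>\<^sup>+x. ennreal (W (x + h) - W x) * indicator {-R..R} x \<partial>lborel) \<le> ennreal (h * V)"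
proof -
  have int: "W integrable_on {a..b}" for a b
    using W by (intro integrable_on_mono_on) (auto simp: mono_def mono_on_def)
  have "(W has_integral integral {-R + h..R + h} W) {-R + h..R + h}"
    using int by (rule integrable_integral)
  from has_integral_shift_real_ivl[OF this, of h]
  have "((\<lambda>x. W (x + h)) has_integral integral {-R + h..R + h} W) {-R..R}" by simp
  from has_integral_diff[OF this integrable_integral[OF int[of "-R" R]]]
  have I: "((\<lambda>x. W (x + h) - W x) has_integral integral {-R + h..R + h} W - integral {-R..R} W) {-R..R}" .
  have eq1: "integral {-R..R + h} W = integral {-R..R} W + integral {R..R + h} W"
    using int h \<open>R \<ge> 0\<close> by (intro Henstock_Kurzweil_Integration.integral_combine[symmetric]) auto
  have eq2: "integral {-R..R + h} W = integral {-R..-R + h} W + integral {-R + h..R + h} W"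
    using int h \<open>R \<ge> 0\<close> by (intro Henstock_Kurzweil_Integration.integral_combine[symmetric]) auto
  have "0 \<le> integral {-R..-R + h} W"
    using int range by (intro Henstock_Kurzweil_Integration.integral_nonneg) auto
  moreover have "integral {R..R + h} W \<le> h * V"
    using integral_le[OF int[of R "R + h"], of "\<lambda>_. V"] range h by auto
  ultimately have le: "integral {-R + h..R + h} W - integral {-R..R} W \<le> h * V"
    using eq1 eq2 by linarith
  have "(\<integral>\<^sup>+x. ennreal (W (x + h) - W x) * indicator {-R..R} x \<partial>lborel) =
      ennreal (integral {-R + h..R + h} W - integral {-R..R} W)"
    using W h I by (intro nn_integral_has_integral_lebesgue') (auto simp: mono_def)
  also have "\<dots> \<le> ennreal (h * V)" using le by (rule ennreal_leI)
  finally show ?thesis .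
qed

text \<open>The p-th power of the difference quotient with step \<open>h n\<close> is at most
  \<open>(W (x + h n) - W x) / h n\<close>, whose integral over every symmetric window is at most
  \<open>V\<close>.\<close>

lemma Riesz_deriv_Lp:
  fixes G W :: "real \<Rightarrow> real"
  assumes p: "p > 1" and W: "mono W" and range: "\<And>x. 0 \<le> W x \<and> W x \<le> V"
    and le: "\<And>x y. x < y \<Longrightarrow> \<bar>G y - G x\<bar> powr p \<le> (W y - W x) * (y - x) powr (p - 1)"
  shows "in_Lp p (deriv G)" "(LINT x|lebesgue. \<bar>deriv G x\<bar> powr p) \<le> V"
proof -
  define h where "h n = 1 / real (Suc n)" for n
  have h: "h n > 0" for n by (simp add: h_def)
  have h0: "h \<longlonglongrightarrow> 0" unfolding h_def by (rule LIMSEQ_inverse_real_of_nat[unfolded inverse_eq_divide])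
  define \<phi> where "\<phi> n x = (G (x + h n) - G x) / h n" for n x
  have cont: "continuous_on UNIV G" by (rule Riesz_continuous[OF p W le])
  have meas[measurable]: "\<phi> n \<in> borel_measurable borel" for n
    unfolding \<phi>_def
    by (intro borel_measurable_continuous_onI continuous_intros continuous_on_compose2[OF cont]) (use h[of n] in auto)
  have lim: "(\<lambda>n. \<phi> n x) \<longlonglongrightarrow> deriv G x" if "G differentiable (at x)" for x
  proof -
    have "(G has_real_derivative deriv G x) (at x)"
      using that by (metis DERIV_deriv_iff_real_differentiable)
    then have "((\<lambda>t. (G (x + t) - G x) / t) \<longlongrightarrow> deriv G x) (at 0)" by (simp add: DERIV_def)
    moreover have "filterlim h (at 0) sequentially"
      using h0 h by (auto simp: filterlim_at intro!: always_eventually less_imp_neq[symmetric])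
    ultimately show ?thesis unfolding \<phi>_def by (rule filterlim_compose)
  qed
  have "{x. \<not> G differentiable (at x)} \<in> null_sets lebesgue"
    using Riesz_differentiable_AE[OF p W le] by (simp add: negligible_iff_null_sets)
  then have "AE x in lebesgue. G differentiable (at x)" by (rule AE_I') auto
  then have ND: "AE x in lborel. G differentiable (at x)" by (simp only: AE_completion_iff)
  have AEl: "AE x in lborel. (\<lambda>n. \<phi> n x) \<longlonglongrightarrow> deriv G x"
    using ND by eventually_elim (rule lim)
  \<comment> \<open>Measurability of \<open>deriv G\<close> comes from its agreeing almost
    everywhere with a limit of Borel functions.\<close>
  have "(\<lambda>x. lim (\<lambda>n. \<phi> n x)) \<in> borel_measurable lebesgue"
    by (intro measurable_completion) measurable
  moreover have "AE x in lebesgue. lim (\<lambda>n. \<phi> n x) = deriv G x"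
    using AE_completion[OF AEl] by eventually_elim (rule limI)
  ultimately have dm[measurable]: "deriv G \<in> borel_measurable lebesgue"
    by (rule borel_measurable_AE)
  \<comment> \<open>The window is bounded, as the shift estimate demands, and exhausts the line as
    \<open>n\<close> grows.\<close>
  define k where "k n x = ennreal (\<bar>\<phi> n x\<bar> powr p) * indicator {- real n..real n} x" for n x
  have k_meas[measurable]: "k n \<in> borel_measurable lborel" for n
    unfolding k_def by measurable
  have k_le: "(\<integral>\<^sup>+x. k n x \<partial>lborel) \<le> ennreal V" for n
  proof -
    have "(\<integral>\<^sup>+x. k n x \<partial>lborel) \<le>
        (\<integral>\<^sup>+x. ennreal (1 / h n) * (ennreal (W (x + h n) - W x) * indicator {- real n..real n} x) \<partial>lborel)"
    proof (rule nn_integral_mono)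
      fix x
      have W0: "0 \<le> W (x + h n) - W x" using W h[of n] by (simp add: mono_def)
      have "\<bar>\<phi> n x\<bar> powr p = \<bar>G (x + h n) - G x\<bar> powr p / h n powr p"
        using h[of n] by (simp add: \<phi>_def powr_divide)
      also have "\<dots> \<le> (W (x + h n) - W x) * h n powr (p - 1) / h n powr p"
        using le[of x "x + h n"] h[of n] by (intro divide_right_mono) auto
      also have "\<dots> = 1 / h n * (W (x + h n) - W x)"
        using h[of n] by (simp add: powr_diff field_simps)
      finally have "ennreal (\<bar>\<phi> n x\<bar> powr p) \<le> ennreal (1 / h n) * ennreal (W (x + h n) - W x)"
        using h[of n] W0 by (simp add: ennreal_mult[symmetric] ennreal_leI)
      then show "k n x \<le> ennreal (1 / h n) * (ennreal (W (x + h n) - W x) * indicator {- real n..real n} x)"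
        unfolding k_def mult.assoc[symmetric] by (rule mult_right_mono) simp
    qed
    also have "\<dots> = ennreal (1 / h n) * (\<integral>\<^sup>+x. ennreal (W (x + h n) - W x) * indicator {- real n..real n} x \<partial>lborel)"
    proof (rule nn_integral_cmult)
      have "W \<in> borel_measurable borel" using W by (rule borel_measurable_mono)
      then show "(\<lambda>x. ennreal (W (x + h n) - W x) * indicator {- real n..real n} x) \<in> borel_measurable lborel"
        by measurable
    qed
    also have "\<dots> \<le> ennreal (1 / h n) * ennreal (h n * V)"
      by (intro mult_left_mono mono_shift_integral_bound[OF W range h]) auto
    also have "\<dots> = ennreal V"
      using h[of n] range[of 0] by (simp add: ennreal_mult[symmetric])
    finally show ?thesis .
  qed
  have "(\<integral>\<^sup>+x. ennreal (\<bar>deriv G x\<bar> powr p) \<partial>lebesgue) = (\<integral>\<^sup>+x. liminf (\<lambda>n. k n x) \<partial>lebesgue)"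
  proof (rule nn_integral_cong_AE, use AE_completion[OF AEl] in eventually_elim)
    fix x assume x: "(\<lambda>n. \<phi> n x) \<longlonglongrightarrow> deriv G x"
    have "(\<lambda>n. \<bar>\<phi> n x\<bar> powr p) \<longlonglongrightarrow> \<bar>deriv G x\<bar> powr p"
      using x p by (intro tendsto_powr' tendsto_rabs tendsto_const) auto
    then have "(\<lambda>n. ennreal (\<bar>\<phi> n x\<bar> powr p)) \<longlonglongrightarrow> ennreal (\<bar>deriv G x\<bar> powr p)"
      by (rule tendsto_ennrealI)
    moreover obtain N where N: "\<bar>x\<bar> \<le> real N" using real_arch_simple by blast
    have "eventually (\<lambda>n. ennreal (\<bar>\<phi> n x\<bar> powr p) = k n x) sequentially"
      using eventually_ge_at_top[of N]
    proof eventually_elim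
      case (elim n)
      then have "real N \<le> real n" by simp
      with N have "x \<in> {- real n..real n}" by auto
      then show ?case by (simp add: k_def)
    qed
    ultimately have "(\<lambda>n. k n x) \<longlonglongrightarrow> ennreal (\<bar>deriv G x\<bar> powr p)"
      by (rule Lim_transform_eventually)
    then show "ennreal (\<bar>deriv G x\<bar> powr p) = liminf (\<lambda>n. k n x)"
      by (simp add: lim_imp_Liminf)
  qed
  also have "\<dots> = (\<integral>\<^sup>+x. liminf (\<lambda>n. k n x) \<partial>lborel)"
    by (intro nn_integral_completion) 
  also have "\<dots> \<le> liminf (\<lambda>n. \<integral>\<^sup>+x. k n x \<partial>lborel)"
    by (rule nn_integral_liminf) measurable
  also have "\<dots> \<le> ennreal V"
    using k_le by (intro Liminf_le always_eventually allI) auto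
  finally have fin: "(\<integral>\<^sup>+x. ennreal (\<bar>deriv G x\<bar> powr p) \<partial>lebesgue) \<le> ennreal V" .
  have pm: "(\<lambda>x. \<bar>deriv G x\<bar> powr p) \<in> borel_measurable lebesgue" by measurable
  have int: "integrable lebesgue (\<lambda>x. \<bar>deriv G x\<bar> powr p)"
    using fin pm by (intro integrableI_nonneg) (auto intro: le_less_trans)
  then show "in_Lp p (deriv G)" using dm by (simp add: in_Lp_def)
  have "ennreal (LINT x|lebesgue. \<bar>deriv G x\<bar> powr p) \<le> ennreal V"
    using fin nn_integral_eq_integral[OF int] by simp
  then show "(LINT x|lebesgue. \<bar>deriv G x\<bar> powr p) \<le> V"
    using range[of 0] by (auto simp: ennreal_le_iff)
qed

section \<open>Necessity\<close>

text \<open>Taylor's estimate without the factorials: the mean value inequality is applied from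
  order \<open>n\<close> downwards, and each step away from the common zero \<open>c\<close> gains a
  factor. A sequence \<open>R\<close> covers both polynomials and remainders of
  \<open>F\<close>.\<close>

lemma iterated_deriv_bound:
  fixes R :: "nat \<Rightarrow> real \<Rightarrow> real"
  assumes deriv: "\<And>i z. i < n \<Longrightarrow> z \<in> {a..b} \<Longrightarrow> (R i has_real_derivative R (Suc i) z) (at z within {a..b})"
    and zero: "\<And>i. i < n \<Longrightarrow> R i c = 0" and c: "c \<in> {a..b}"
    and bound: "\<And>z. z \<in> {a..b} \<Longrightarrow> \<bar>R n z\<bar> \<le> B"
    and "i \<le> n" "z \<in> {a..b}"
  shows "\<bar>R i z\<bar> \<le> B * \<bar>z - c\<bar> ^ (n - i)"
  using assms(5,6)
proof (induction "n - i" arbitrary: i z)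
  case 0
  then show ?case using bound[of z] by simp
next
  case (Suc k)
  then have i: "i < n" and ni: "n - i = Suc (n - Suc i)" by simp_all
  have B: "B \<ge> 0" using bound[OF c] by (meson abs_ge_zero order_trans)
  let ?S = "closed_segment c z"
  have sub: "?S \<subseteq> {a..b}" using c Suc.prems(2) closed_segment_subset[of c "{a..b}" z] by simp
  have "norm (R i z - R i c) \<le> B * \<bar>z - c\<bar> ^ (n - Suc i) * norm (z - c)"
  proof (rule field_differentiable_bound[of ?S])
    show "(R i has_real_derivative R (Suc i) w) (at w within ?S)" if "w \<in> ?S" for w
      using deriv[OF i] sub that by (meson DERIV_subset subsetD)
    show "norm (R (Suc i) w) \<le> B * \<bar>z - c\<bar> ^ (n - Suc i)" if w: "w \<in> ?S" for w
    proof -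
      have "\<bar>R (Suc i) w\<bar> \<le> B * \<bar>w - c\<bar> ^ (n - Suc i)"
        using Suc.hyps(2) i w sub by (intro Suc.hyps(1)) auto
      also have "\<dots> \<le> B * \<bar>z - c\<bar> ^ (n - Suc i)"
        using w B by (intro mult_left_mono power_mono) (auto simp: closed_segment_eq_real_ivl split: if_splits)
      finally show ?thesis by simp
    qed
  qed auto
  then show ?case using zero[OF i] by (simp add: ni mult_ac)
qed

section \<open>Derivatives and degrees of Taylor polynomials\<close>

lemma pderiv_taylor_poly: "pderiv (taylor_poly (Suc n) x F) = taylor_poly n x (deriv F)"
proof -
  have 1: "smult (a / fact (Suc k)) (pderiv ([:- x, 1:] ^ Suc k)) = smult (a / fact k) ([:- x, 1:] ^ k)"
    for a :: real and k
  proof -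
    have "(1 + real k) * (a / ((1 + real k) * fact k)) = a / fact k"
      by (simp add: field_simps add_nonneg_eq_0_iff)
    then show ?thesis
      by (simp add: pderiv_power_Suc pderiv_pCons del: power_Suc)
  qed
  show ?thesis
    unfolding taylor_poly_def sum.atMost_Suc_shift
    by (simp add: pderiv_add pderiv_smult higher_pderiv_sum[of 1, simplified] 1 funpow_swap1 del: power_Suc fact_Suc)
qed

lemma higher_pderiv_taylor_poly:
  "i \<le> n \<Longrightarrow> (pderiv ^^ i) (taylor_poly n x F) = taylor_poly (n - i) x ((deriv ^^ i) F)"
proof (induction i)
  case (Suc i)
  then have "n - i = Suc (n - Suc i)" by simp
  with Suc show ?case by (simp add: pderiv_taylor_poly)
qed simp

lemma poly_taylor_poly_self: "poly (taylor_poly n x F) x = F x"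
  by (simp add: taylor_poly_def poly_sum power_0_left sum.delta if_distrib cong: if_cong)

lemma poly_higher_pderiv_taylor_poly:
  "i \<le> n \<Longrightarrow> poly ((pderiv ^^ i) (taylor_poly n x F)) x = (deriv ^^ i) F x"
  by (simp add: higher_pderiv_taylor_poly poly_taylor_poly_self)

lemma degree_taylor_poly: "degree (taylor_poly n x F) \<le> n"
  unfolding taylor_poly_def
proof (rule degree_sum_le)
  fix k assume "k \<in> {..n}"
  have "degree (smult ((deriv ^^ k) F x / fact k) ([:- x, 1:] ^ k)) \<le> degree ([:- x, 1:] ^ k)"
    by (rule degree_smult_le)
  also have "\<dots> \<le> n" using \<open>k \<in> {..n}\<close> by (simp add: degree_linear_power)
  finally show "degree (smult ((deriv ^^ k) F x / fact k) ([:- x, 1:] ^ k)) \<le> n" .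
qed simp

lemma higher_pderiv_eq_0:
  fixes Q :: "real poly"
  assumes "degree Q < n"
  shows "(pderiv ^^ n) Q = 0"
proof (cases n)
  case (Suc k)
  have "degree ((pderiv ^^ k) Q) = 0" using assms Suc by (simp add: degree_higher_pderiv)
  then show ?thesis using Suc by (simp add: pderiv_eq_0_iff)
qed (use assms in simp)

lemma poly_const_if_degree_0: "degree Q = 0 \<Longrightarrow> poly Q x = poly Q y"
  by (erule degree_eq_zeroE) simp

section \<open>Variation sums of the jets of a Sobolev function\<close>

context
  fixes m :: nat and p :: real and F :: "real \<Rightarrow> real"
  assumes m: "m \<ge> 1" and p: "p > 1" and F: "F \<in> sobolev m p"
begin

text \<open>The bounded monotone function controlling the increments of the derivative of order
  \<open>m - 1\<close>; its increments telescope along a sequence.\<close>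

definition energy :: "real \<Rightarrow> real" where
  "energy x = integral {..x} (\<lambda>t. \<bar>(deriv ^^ m) F t\<bar> powr p)"

private lemma energy_integrable: "S \<in> sets lebesgue \<Longrightarrow> (\<lambda>t. \<bar>(deriv ^^ m) F t\<bar> powr p) integrable_on S"
proof -
  assume S: "S \<in> sets lebesgue"
  have "set_integrable lebesgue UNIV (\<lambda>t. \<bar>(deriv ^^ m) F t\<bar> powr p)"
    using F by (simp add: sobolev_def in_Lp_def set_integrable_def)
  then have "(\<lambda>t. \<bar>(deriv ^^ m) F t\<bar> powr p) absolutely_integrable_on S"
    using S by (rule set_integrable_subset) simp
  then show ?thesis by (rule set_lebesgue_integral_eq_integral)
qed

lemma energy_diff:
  assumes "x \<le> y"
  shows "energy y - energy x = integral {x..y} (\<lambda>t. \<bar>(deriv ^^ m) F t\<bar> powr p)"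
proof -
  have "{..x} \<union> {x..y} = {..y}" using assms by auto
  moreover have "negligible ({..x} \<inter> {x..y})"
    by (rule negligible_subset[of "{x}"]) auto
  ultimately show ?thesis
    using Henstock_Kurzweil_Integration.integral_Un[OF energy_integrable[of "{..x}"] energy_integrable[of "{x..y}"]]
    by (simp add: energy_def)
qed

lemma energy_mono: "x \<le> y \<Longrightarrow> energy x \<le> energy y"
  using energy_diff[of x y] Henstock_Kurzweil_Integration.integral_nonneg[OF energy_integrable[of "{x..y}"]] by simp

lemma energy_range: "0 \<le> energy x" "energy x \<le> sobolev_seminorm m p F powr p"
proof -
  let ?w = "\<lambda>t. \<bar>(deriv ^^ m) F t\<bar> powr p"
  show "0 \<le> energy x" unfolding energy_def
    by (rule Henstock_Kurzweil_Integration.integral_nonneg[OF energy_integrable]) auto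
  have "(?w has_integral (LINT t|lebesgue. ?w t)) UNIV"
    using F by (intro has_integral_integral_lebesgue) (simp add: sobolev_def in_Lp_def)
  then have eq: "integral UNIV ?w = (LINT t|lebesgue. ?w t)" by (rule integral_unique)
  have "energy x \<le> integral UNIV ?w"
    unfolding energy_def by (rule integral_subset_le) (auto intro: energy_integrable)
  also have "\<dots> = sobolev_seminorm m p F powr p"
    unfolding eq sobolev_seminorm_def Lp_norm_def using p by (simp add: powr_powr)
  finally show "energy x \<le> sobolev_seminorm m p F powr p" .
qed

text \<open>Hoelder's inequality up to the factor \<open>2 powr p\<close>: the integrand is bounded
  pointwise at every scale \<open>M\<close> (the case \<open>h = 1\<close> of the scale inequality),
  and the integrated bounds are then optimised over \<open>M\<close>.\<close>

lemma energy_increment: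
  assumes xy: "x < y"
  shows "\<bar>(deriv ^^ (m - 1)) F y - (deriv ^^ (m - 1)) F x\<bar> powr p
    \<le> 2 powr p * ((energy y - energy x) * (y - x) powr (p - 1))"
proof -
  let ?G = "(deriv ^^ (m - 1)) F" and ?g = "(deriv ^^ m) F"
  have g: "?g = deriv ?G" using m by (cases m) auto
  have ae: "AE x in lebesgue. ?G differentiable (at x)" and ac: "abs_cont_on x y ?G"
    using F xy by (auto simp: sobolev_def locally_abs_cont_def)
  have N: "negligible {x. \<not> ?G differentiable (at x)}"
    using ae by (simp add: negligible_iff_null_sets completion.AE_iff_null_sets)
  have I: "(?g has_integral (?G y - ?G x)) {x..y}"
    unfolding g
    by (rule abs_cont_has_integral[OF ac _ N]) (use xy in \<open>auto simp: DERIV_deriv_iff_real_differentiable\<close>)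
  have w: "(\<lambda>t. \<bar>?g t\<bar> powr p) integrable_on {x..y}" by (rule energy_integrable) simp
  have wc: "(\<lambda>t. c * \<bar>?g t\<bar> powr p) integrable_on {x..y}" for c
    using integrable_cmul[OF w, of c] by simp
  show ?thesis
  proof (rule powr_le_if_all_scales[OF p])
    fix M :: real assume M: "M > 0"
    have "norm (integral {x..y} ?g) \<le> integral {x..y} (\<lambda>t. M + M powr (1 - p) * \<bar>?g t\<bar> powr p)"
    proof (rule integral_norm_bound_integral)
      show "norm (?g t) \<le> M + M powr (1 - p) * \<bar>?g t\<bar> powr p" for t
        using le_all_scales_if_powr_le[OF p, of "\<bar>?g t\<bar>" 1 "\<bar>?g t\<bar> powr p" M] M by simp
    qed (use I wc in \<open>auto intro!: integrable_add\<close>)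
    also have "\<dots> = M * (y - x) + M powr (1 - p) * (energy y - energy x)"
      using wc xy by (subst Henstock_Kurzweil_Integration.integral_add) (auto simp: energy_diff)
    finally show "\<bar>?G y - ?G x\<bar> \<le> M * (y - x) + M powr (1 - p) * (energy y - energy x)"
      using integral_unique[OF I] by simp
  qed (use xy energy_mono[of x y] in auto)
qed

text \<open>Expand at \<open>y\<close> and evaluate at \<open>x\<close>: the derivatives of
  \<open>F\<close> minus \<open>P y\<close> below order \<open>m - 1\<close> vanish at
  \<open>y\<close>, and the one of order \<open>m - 1\<close> is an increment of that derivative of
  \<open>F\<close>.\<close>

lemma jet_difference_le_energy:
  assumes xy: "x < y" and i: "i < m"
    and T: "taylor_poly (m - 1) x F = P x" "taylor_poly (m - 1) y F = P y"
  shows "\<bar>poly ((pderiv ^^ i) (P x)) x - poly ((pderiv ^^ i) (P y)) x\<bar> powr p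
      / (y - x) powr ((real m - real i) * p - 1) \<le> 2 powr p * (energy y - energy x)"
proof -
  define R where "R i z = (deriv ^^ i) F z - poly ((pderiv ^^ i) (P y)) z" for i z
  define S where "S = 2 powr p * ((energy y - energy x) * (y - x) powr (p - 1))"
  have S: "S \<ge> 0" using energy_mono[of x y] xy by (simp add: S_def)
  have Px: "poly ((pderiv ^^ i) (P x)) x = (deriv ^^ i) F x"
    unfolding T[symmetric] by (rule poly_higher_pderiv_taylor_poly) (use i in linarith)
  have Py: "poly ((pderiv ^^ i) (P y)) y = (deriv ^^ i) F y" if "i < m" for i
    unfolding T[symmetric] by (rule poly_higher_pderiv_taylor_poly) (use that in linarith)
  have "\<bar>R i x\<bar> \<le> S powr (1 / p) * \<bar>x - y\<bar> ^ (m - 1 - i)"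
  proof (rule iterated_deriv_bound[of "m - 1" x y])
    fix i z assume "i < m - 1" "z \<in> {x..y}"
    then have "(deriv ^^ i) F differentiable (at z)" using F by (auto simp: sobolev_def has_derivs_def)
    then have "((deriv ^^ i) F has_real_derivative (deriv ^^ Suc i) F z) (at z within {x..y})"
      by (auto simp: DERIV_deriv_iff_real_differentiable intro: has_field_derivative_at_within)
    then show "(R i has_real_derivative R (Suc i) z) (at z within {x..y})"
      unfolding R_def by (auto intro!: derivative_eq_intros poly_DERIV[THEN has_field_derivative_at_within])
  next
    show "R i y = 0" if "i < m - 1" for i using Py[of i] that by (simp add: R_def)
  next
    fix z assume z: "z \<in> {x..y}"
    \<comment> \<open>The top derivative of \<open>P y\<close> is constant, so its value at
      \<open>z\<close> is its value at \<open>y\<close>.\<close>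
    have "degree ((pderiv ^^ (m - 1)) (P y)) = 0"
      using degree_taylor_poly[of "m - 1" y F] T by (simp add: degree_higher_pderiv)
    then have "poly ((pderiv ^^ (m - 1)) (P y)) z = (deriv ^^ (m - 1)) F y"
      using Py[of "m - 1"] m by (metis One_nat_def diff_less le_eq_less_or_eq less_le_trans poly_const_if_degree_0 zero_less_one)
    then have eq: "\<bar>R (m - 1) z\<bar> = \<bar>(deriv ^^ (m - 1)) F y - (deriv ^^ (m - 1)) F z\<bar>"
      by (simp add: R_def)
    have "\<bar>R (m - 1) z\<bar> powr p \<le> S"
    proof (cases "z = y")
      case False
      then have "z < y" using z by simp
      from energy_increment[OF this] show ?thesis
        unfolding eq S_def
        by (rule order_trans) (use z energy_mono[of x z] energy_mono[of z y] p in
          \<open>auto intro!: mult_left_mono mult_mono powr_mono2\<close>)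
    qed (use S eq in auto)
    then have "(\<bar>R (m - 1) z\<bar> powr p) powr (1 / p) \<le> S powr (1 / p)"
      using p by (intro powr_mono2) auto
    then show "\<bar>R (m - 1) z\<bar> \<le> S powr (1 / p)" using p by (simp add: powr_powr)
  qed (use xy i in auto)
  then have "\<bar>R i x\<bar> powr p \<le> (S powr (1 / p) * (y - x) ^ (m - 1 - i)) powr p"
    using p xy by (intro powr_mono2) auto
  also have "\<dots> = S * (y - x) powr (real (m - 1 - i) * p)"
    using p xy S by (simp add: powr_mult powr_powr powr_realpow[symmetric])
  also have "\<dots> = 2 powr p * (energy y - energy x) * ((y - x) powr (p - 1) * (y - x) powr (real (m - 1 - i) * p))"
    by (simp add: S_def)
  also have "(y - x) powr (p - 1) * (y - x) powr (real (m - 1 - i) * p) = (y - x) powr ((real m - real i) * p - 1)"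
    using i m by (simp add: powr_add[symmetric] of_nat_diff algebra_simps)
  finally show ?thesis using xy Px by (simp add: R_def pos_divide_le_eq)
qed

lemma variation_quantity_le:
  assumes T: "\<And>x. x \<in> E \<Longrightarrow> taylor_poly (m - 1) x F = P x"
  shows "variation_quantity m p E P \<le> ennreal (2 * real m) * ennreal (sobolev_seminorm m p F)"
  unfolding variation_quantity_def
proof (rule Sup_least, clarify)
  fix k :: nat and x :: "nat \<Rightarrow> real"
  assume k: "k > 1" and mono: "strict_mono_on {1..k} x" and xE: "x ` {1..k} \<subseteq> E"
  let ?t = "\<lambda>j i. \<bar>poly ((pderiv ^^ i) (P (x j))) (x j) - poly ((pderiv ^^ i) (P (x (j + 1)))) (x j)\<bar> powr p
      / (x (j + 1) - x j) powr ((real m - real i) * p - 1)"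
  let ?N = "sobolev_seminorm m p F"
  have N: "?N \<ge> 0" by (simp add: sobolev_seminorm_def Lp_norm_def)
  have "(\<Sum>j=1..k-1. \<Sum>i=0..m-1. ?t j i) \<le> (\<Sum>j=1..k-1. \<Sum>i=0..m-1. 2 powr p * (energy (x (j + 1)) - energy (x j)))"
  proof (intro sum_mono)
    fix j i assume j: "j \<in> {1..k-1}" and i: "i \<in> {0..m-1}"
    have "j \<in> {1..k}" "j + 1 \<in> {1..k}" using j by auto
    then have "x j < x (j + 1)" "x j \<in> E" "x (j + 1) \<in> E"
      using mono xE by (auto simp: strict_mono_on_def)
    then show "?t j i \<le> 2 powr p * (energy (x (j + 1)) - energy (x j))"
      using i m T by (intro jet_difference_le_energy) auto
  qed
  also have "\<dots> = real m * 2 powr p * (\<Sum>j=1..k-1. energy (x (Suc j)) - energy (x j))"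
    using m by (simp add: sum_distrib_left mult_ac)
  also have "(\<Sum>j=1..k-1. energy (x (Suc j)) - energy (x j)) = energy (x k) - energy (x 1)"
    using sum_Suc_diff[of 1 "k - 1" "\<lambda>j. energy (x j)"] k by simp
  also have "real m * 2 powr p * (energy (x k) - energy (x 1)) \<le> real m * 2 powr p * ?N powr p"
    using energy_range[of "x k"] energy_range[of "x 1"] by (intro mult_left_mono) auto
  finally have "(\<Sum>j=1..k-1. \<Sum>i=0..m-1. ?t j i) \<le> real m * 2 powr p * ?N powr p" .
  then have "(\<Sum>j=1..k-1. \<Sum>i=0..m-1. ?t j i) powr (1 / p) \<le> (real m * 2 powr p * ?N powr p) powr (1 / p)"
    using p by (intro powr_mono2) (auto intro!: sum_nonneg)
  also have "\<dots> = real m powr (1 / p) * 2 * ?N"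
    using p N by (simp add: powr_mult powr_powr)
  \<comment> \<open>Bounding \<open>real m powr (1 / p)\<close> by \<open>real m\<close> removes
    \<open>p\<close> from the constant.\<close>
  also have "\<dots> \<le> 2 * real m * ?N"
    using powr_mono[of "1 / p" 1 "real m"] N m p by (simp add: mult_right_mono)
  finally have "(\<Sum>j=1..k-1. \<Sum>i=0..m-1. ?t j i) powr (1 / p) \<le> 2 * real m * ?N" .
  then show "ennreal ((\<Sum>j=1..k-1. \<Sum>i=0..m-1. ?t j i) powr (1 / p)) \<le> ennreal (2 * real m) * ennreal ?N"
    using N by (simp add: ennreal_mult[symmetric] ennreal_leI)
qed

end

section \<open>Interpolation in the gaps and extension\<close>

text \<open>The weights \<open>h ^ k\<close> make this bound on a jet invariant under rescaling of
  the line, with \<open>h\<close> the length of the interval considered.\<close>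

definition jet_le :: "real \<Rightarrow> real \<Rightarrow> real poly \<Rightarrow> real \<Rightarrow> bool" where
  "jet_le h \<beta> Q x \<longleftrightarrow> (\<forall>k. \<bar>poly ((pderiv ^^ k) Q) x\<bar> * h ^ k \<le> \<beta>)"

lemma jet_leD: "jet_le h \<beta> Q x \<Longrightarrow> \<bar>poly ((pderiv ^^ k) Q) x\<bar> * h ^ k \<le> \<beta>"
  by (simp add: jet_le_def)

lemma jet_le_nonneg: "jet_le h \<beta> Q x \<Longrightarrow> 0 \<le> \<beta>"
  using jet_leD[of h \<beta> Q x 0] by simp

lemma jet_le_pderiv:
  assumes "jet_le h \<beta> Q x" "h > 0"
  shows "jet_le h (\<beta> / h) (pderiv Q) x"
  unfolding jet_le_def
proof
  fix k
  show "\<bar>poly ((pderiv ^^ k) (pderiv Q)) x\<bar> * h ^ k \<le> \<beta> / h"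
    using jet_leD[OF assms(1), of "Suc k"] assms(2) by (simp add: funpow_swap1 pos_le_divide_eq mult_ac)
qed

text \<open>Induction on the degree bound: the jet of the derivative is moved first, and the mean
  value inequality then adds one more \<beta> for \<open>Q\<close> itself.\<close>

lemma jet_le_shift:
  assumes "degree Q < n" "jet_le h \<beta> Q x" "\<bar>z - x\<bar> \<le> h" "h > 0"
  shows "jet_le h (real n * \<beta>) Q z"
  using assms
proof (induction n arbitrary: Q \<beta> z)
  case (Suc n)
  have \<beta>: "\<beta> \<ge> 0" using Suc.prems(2) by (rule jet_le_nonneg)
  have D: "jet_le h (real n * (\<beta> / h)) (pderiv Q) w" if "\<bar>w - x\<bar> \<le> h" for w
  proof (cases "degree Q = 0")
    case True
    then have "pderiv Q = 0" by (simp add: pderiv_eq_0_iff)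
    then show ?thesis using \<beta> Suc.prems(4) by (simp add: jet_le_def)
  next
    case False
    then show ?thesis
      using Suc.prems that by (intro Suc.IH jet_le_pderiv) (auto simp: degree_pderiv)
  qed
  show ?case
    unfolding jet_le_def
  proof
    fix k
    show "\<bar>poly ((pderiv ^^ k) Q) z\<bar> * h ^ k \<le> real (Suc n) * \<beta>"
    proof (cases k)
      case 0
      have "norm (poly Q z - poly Q x) \<le> (real n * (\<beta> / h)) * norm (z - x)"
      proof (rule field_differentiable_bound[of "cball x h"])
        show "(poly Q has_field_derivative poly (pderiv Q) w) (at w within cball x h)" for w
          by (rule poly_DERIV[THEN has_field_derivative_at_within])
        show "norm (poly (pderiv Q) w) \<le> real n * (\<beta> / h)" if "w \<in> cball x h" for w
          using jet_leD[OF D, of w 0] that by (simp add: dist_real_def abs_minus_commute)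
      qed (use Suc.prems in \<open>auto simp: dist_real_def abs_minus_commute\<close>)
      also have "\<dots> \<le> (real n * (\<beta> / h)) * h"
        using Suc.prems \<beta> by (intro mult_left_mono) auto
      finally have "\<bar>poly Q z - poly Q x\<bar> \<le> real n * \<beta>" using Suc.prems(4) by simp
      moreover have "\<bar>poly Q x\<bar> \<le> \<beta>" using jet_leD[OF Suc.prems(2), of 0] by simp
      ultimately show ?thesis by (simp add: 0 algebra_simps)
    next
      case (Suc j)
      have "\<bar>poly ((pderiv ^^ j) (pderiv Q)) z\<bar> * h ^ j \<le> real n * (\<beta> / h)"
        using D[OF \<open>\<bar>z - x\<bar> \<le> h\<close>] by (rule jet_leD)
      then have "\<bar>poly ((pderiv ^^ k) Q) z\<bar> * h ^ k \<le> real n * \<beta>"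
        using \<open>h > 0\<close> by (simp add: Suc funpow_swap1 pos_le_divide_eq mult_ac)
      then show ?thesis using \<beta> by (simp add: algebra_simps)
    qed
  qed
qed simp

text \<open>The product rule doubles the number of terms with each derivative, whence the factor
  \<open>2 ^ k\<close>.\<close>

lemma jet_mult_bound:
  assumes "jet_le h \<alpha> A x" "jet_le h \<beta> B x" "h > 0"
  shows "\<bar>poly ((pderiv ^^ k) (A * B)) x\<bar> * h ^ k \<le> 2 ^ k * (\<alpha> * \<beta>)"
  using assms(1,2)
proof (induction k arbitrary: A B \<alpha> \<beta>)
  case 0
  then show ?case
    using jet_leD[of h \<alpha> A x 0] jet_leD[of h \<beta> B x 0] jet_le_nonneg[OF 0(1)]
    by (auto simp: abs_mult intro: mult_mono)
next
  case (Suc k)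
  let ?u = "poly ((pderiv ^^ k) (A * pderiv B)) x" and ?v = "poly ((pderiv ^^ k) (B * pderiv A)) x"
  have "\<bar>?u\<bar> * h ^ k \<le> 2 ^ k * (\<alpha> * (\<beta> / h))" "\<bar>?v\<bar> * h ^ k \<le> 2 ^ k * (\<beta> * (\<alpha> / h))"
    by (rule Suc.IH; use Suc.prems assms(3) in \<open>auto intro: jet_le_pderiv\<close>)+
  then have "\<bar>?u\<bar> * h ^ Suc k \<le> 2 ^ k * (\<alpha> * \<beta>)" "\<bar>?v\<bar> * h ^ Suc k \<le> 2 ^ k * (\<alpha> * \<beta>)"
    using assms(3) by (simp_all add: pos_le_divide_eq mult_ac)
  moreover have "\<bar>?u + ?v\<bar> * h ^ Suc k \<le> (\<bar>?u\<bar> + \<bar>?v\<bar>) * h ^ Suc k"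
    using assms(3) by (intro mult_right_mono) auto
  ultimately have "\<bar>?u + ?v\<bar> * h ^ Suc k \<le> 2 ^ Suc k * (\<alpha> * \<beta>)"
    by (simp add: algebra_simps)
  then show ?case
    by (simp add: funpow_swap1 pderiv_mult higher_pderiv_add del: power_Suc)
qed

section \<open>Polynomials with prescribed or vanishing jets\<close>

lemma higher_pderiv_diff: "(pderiv ^^ k) (A - B) = (pderiv ^^ k) A - (pderiv ^^ k) (B :: real poly)"
  by (induction k) (simp_all add: pderiv_diff)

lemma poly_eq_if_jets_eq:
  fixes A B :: "real poly"
  assumes "degree A < n" "degree B < n"
    and eq: "\<And>k. k < n \<Longrightarrow> poly ((pderiv ^^ k) A) x = poly ((pderiv ^^ k) B) x"
  shows "A = B"
proof -
  let ?Q = "A - B"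
  have deg: "degree ?Q < n" using assms(1,2) by (rule degree_diff_less)
  have "poly ((pderiv ^^ k) ?Q) x = 0" for k
  proof (cases "k < n")
    case True
    then show ?thesis using eq by (simp add: higher_pderiv_diff)
  next
    case False
    with deg have "degree ?Q < k" by simp
    then show ?thesis by (simp add: higher_pderiv_eq_0)
  qed
  then have jet: "jet_le h 0 ?Q x" for h by (simp add: jet_le_def)
  have "poly ?Q z = 0" for z
    using jet_leD[OF jet_le_shift[OF deg jet, of z "\<bar>z - x\<bar> + 1"], of 0] by simp
  then show ?thesis using poly_all_0_iff_0[of ?Q] by simp
qed

lemma higher_pderiv_pcompose_linear:
  fixes \<theta> :: "real poly"
  shows "(pderiv ^^ k) (pcompose \<theta> [:c, d:]) = smult (d ^ k) (pcompose ((pderiv ^^ k) \<theta>) [:c, d:])"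
  by (induction k) (simp_all add: pderiv_smult pderiv_pcompose pderiv_pCons mult_ac)

lemma pcompose_power: "pcompose (A ^ n) q = pcompose (A :: real poly) q ^ n"
  by (induction n) (simp_all add: pcompose_mult pcompose_1)

lemma power_dvd_higher_pderiv:
  fixes q :: "real poly"
  shows "i \<le> n \<Longrightarrow> q ^ n dvd R \<Longrightarrow> q ^ (n - i) dvd (pderiv ^^ i) R"
proof (induction i)
  case (Suc i)
  then have "q ^ Suc (n - Suc i) dvd (pderiv ^^ i) R" by (simp add: Suc_diff_Suc)
  then obtain S where "(pderiv ^^ i) R = q ^ Suc (n - Suc i) * S" by (rule dvdE)
  then show ?case
    by (simp add: pderiv_mult pderiv_power_Suc del: power_Suc)
      (simp add: dvd_add dvd_mult dvd_mult2 dvd_smult)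
qed simp

lemma jet_vanishes:
  fixes q :: "real poly"
  assumes "q ^ n dvd R" "poly q x = 0" "i < n"
  shows "poly ((pderiv ^^ i) R) x = 0"
proof -
  have "q dvd q ^ (n - i)" using assms(3) by (intro dvd_power) simp
  also have "q ^ (n - i) dvd (pderiv ^^ i) R" using assms by (intro power_dvd_higher_pderiv) auto
  finally show ?thesis using assms(2) by (auto elim!: dvdE)
qed

text \<open>Powers of comaximal elements are comaximal: multiply two representations of 1 and
  regroup. It supplies a polynomial flat at two points without an explicit formula.\<close>

lemma bezout_powers:
  fixes x y :: "'a :: comm_ring_1"
  assumes "x + y = 1"
  shows "\<exists>u v. u * x ^ n + v * y ^ n = 1"
proof -
  have 1: "\<exists>u v. u * x ^ n + v * y = 1"
  proof (induction n)
    case 0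
    show ?case by (intro exI[of _ 1] exI[of _ 0]) simp
  next
    case (Suc n)
    then obtain u v where uv: "u * x ^ n + v * y = 1" by blast
    have "1 = (u * x ^ n + v * y) * (x + y)" using uv assms by simp
    also have "\<dots> = u * x ^ Suc n + (u * x ^ n + v * (x + y)) * y" by (simp add: algebra_simps)
    finally show ?case by metis
  qed
  have "\<exists>u v. u * x ^ n + v * y ^ k = 1" for k
  proof (induction k)
    case 0
    show ?case by (intro exI[of _ 0] exI[of _ 1]) simp
  next
    case (Suc k)
    then obtain u v where uv: "u * x ^ n + v * y ^ k = 1" by blast
    obtain u' v' where uv': "u' * x ^ n + v' * y = 1" using 1 by blast
    have "1 = (u * x ^ n + v * y ^ k) * (u' * x ^ n + v' * y)" using uv uv' by simp
    also have "\<dots> = (u * (u' * x ^ n + v' * y) + v * y ^ k * u') * x ^ n + (v * v') * y ^ Suc k"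
      by (simp add: algebra_simps)
    finally show ?case by metis
  qed
  then show ?thesis .
qed

lemma poly_derivs_bounded:
  fixes \<theta> :: "real poly"
  shows "\<exists>B\<ge>1. \<forall>t\<in>{0..1}. \<forall>k. \<bar>poly ((pderiv ^^ k) \<theta>) t\<bar> \<le> B"
proof -
  let ?n = "Suc (degree \<theta>)"
  define \<beta> where "\<beta> = (\<Sum>k<?n. \<bar>poly ((pderiv ^^ k) \<theta>) 0\<bar>)"
  have "jet_le 1 \<beta> \<theta> 0"
    unfolding jet_le_def
  proof
    fix k
    show "\<bar>poly ((pderiv ^^ k) \<theta>) 0\<bar> * 1 ^ k \<le> \<beta>"
    proof (cases "k < ?n")
      case True
      then show ?thesis unfolding \<beta>_def
        using member_le_sum[of k "{..<?n}" "\<lambda>k. \<bar>poly ((pderiv ^^ k) \<theta>) 0\<bar>"] by simp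
    next
      case False
      then show ?thesis by (simp add: \<beta>_def higher_pderiv_eq_0 sum_nonneg)
    qed
  qed
  then have "jet_le 1 (real ?n * \<beta>) \<theta> t" if "t \<in> {0..1}" for t
    using that by (intro jet_le_shift[where x = 0]) auto
  then show ?thesis
    by (intro exI[of _ "max 1 (real ?n * \<beta>)"]) (auto simp: jet_le_def le_max_iff_disj)
qed

text \<open>The interpolating polynomial is \<open>A + \<theta>((x - a) / (b - a)) (B - A)\<close> for a fixed polynomial \<open>\<theta>\<close> that
  is flat to order \<open>m\<close> at 0 and at 1, with values 0 and 1.\<close>

lemma gap_interpolation:
  fixes m :: nat
  shows "\<exists>K\<ge>1. \<forall>a b A B. \<exists>H. a < b \<longrightarrow> degree A < m \<longrightarrow> degree B < m \<longrightarrow>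
    (\<forall>\<beta> c. c \<in> {a..b} \<longrightarrow> jet_le (b - a) \<beta> (A - B) c \<longrightarrow>
      (\<forall>z\<in>{a..b}. \<forall>i\<le>m. \<bar>poly ((pderiv ^^ i) (H - A)) z\<bar> \<le> K * \<beta> / (b - a) ^ m * (z - a) ^ (m - i) \<and>
        \<bar>poly ((pderiv ^^ i) (H - B)) z\<bar> \<le> K * \<beta> / (b - a) ^ m * (b - z) ^ (m - i)))"
proof -
  \<comment> \<open>The polynomials X and 1 - X have sum 1. Hence \<theta> below is divisible by the
    m-th power of X, while 1 - \<theta> is divisible by that of 1 - X.\<close>
  obtain u v :: "real poly" where uv: "u * [:0, 1:] ^ m + v * [:1, -1:] ^ m = 1"
    using bezout_powers[of "[:0, 1:]" "[:1, -1::real:]" m] by (auto simp: one_pCons)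
  define \<theta> where "\<theta> = u * [:0, 1:] ^ m"
  obtain L where L: "L \<ge> 1" "\<And>t k. t \<in> {0..1} \<Longrightarrow> \<bar>poly ((pderiv ^^ k) \<theta>) t\<bar> \<le> L"
    using poly_derivs_bounded[of \<theta>] by blast
  \<comment> \<open>\<open>2 ^ m\<close> comes from the product rule, \<open>L\<close> from the
    derivatives of \<theta>, and \<open>real m\<close> from moving the jet of \<open>A - B\<close>
    away from \<open>c\<close>.\<close>
  define K where "K = max 1 (2 ^ m * (L * real m))"
  show ?thesis
  proof (intro exI[of _ K] conjI allI)
    show "K \<ge> 1" by (simp add: K_def)
    fix a b :: real and A B :: "real poly"
    define \<tau> where "\<tau> = [:- a / (b - a), 1 / (b - a):]"
    define Q where "Q = B - A"
    define R where "R = pcompose \<theta> \<tau> * Q"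
    have "\<bar>poly ((pderiv ^^ i) (A + R - A)) z\<bar> \<le> K * \<beta> / (b - a) ^ m * (z - a) ^ (m - i) \<and>
        \<bar>poly ((pderiv ^^ i) (A + R - B)) z\<bar> \<le> K * \<beta> / (b - a) ^ m * (b - z) ^ (m - i)"
      if ab: "a < b" and A: "degree A < m" and B: "degree B < m" and c: "c \<in> {a..b}"
        and jet: "jet_le (b - a) \<beta> (A - B) c" and z: "z \<in> {a..b}" and i: "i \<le> m" for \<beta> c z i
    proof -
      have \<beta>: "\<beta> \<ge> 0" using jet by (rule jet_le_nonneg)
      have jQ: "jet_le (b - a) (real m * \<beta>) Q w" if "w \<in> {a..b}" for w
      proof (rule jet_le_shift)
        show "degree Q < m" unfolding Q_def using A B by (intro degree_diff_less)
        show "jet_le (b - a) \<beta> Q c"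
          using jet by (simp add: jet_le_def Q_def higher_pderiv_diff abs_minus_commute)
      qed (use that c ab in auto)
      have j\<theta>: "jet_le (b - a) L (pcompose \<theta> \<tau>) w" if "w \<in> {a..b}" for w
        unfolding jet_le_def
      proof
        fix k
        have "poly \<tau> w = (w - a) / (b - a)" by (simp add: \<tau>_def diff_divide_distrib)
        then have "poly \<tau> w \<in> {0..1}" using that ab by (simp add: pos_divide_le_eq)
        then have "\<bar>poly ((pderiv ^^ k) \<theta>) (poly \<tau> w)\<bar> \<le> L" by (rule L(2))
        then show "\<bar>poly ((pderiv ^^ k) (pcompose \<theta> \<tau>)) w\<bar> * (b - a) ^ k \<le> L"
          using ab unfolding \<tau>_def
          by (simp add: higher_pderiv_pcompose_linear poly_pcompose abs_mult power_divide)
      qed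
      have Rm: "\<bar>poly ((pderiv ^^ m) R) w\<bar> \<le> K * \<beta> / (b - a) ^ m" if "w \<in> {a..b}" for w
      proof -
        have "\<bar>poly ((pderiv ^^ m) R) w\<bar> * (b - a) ^ m \<le> 2 ^ m * (L * (real m * \<beta>))"
          unfolding R_def using that ab by (intro jet_mult_bound j\<theta> jQ) auto
        also have "\<dots> = (2 ^ m * (L * real m)) * \<beta>" by simp
        also have "\<dots> \<le> K * \<beta>" using \<beta> by (intro mult_right_mono) (auto simp: K_def)
        finally show ?thesis using ab by (simp add: pos_le_divide_eq)
      qed
      have pd: "(poly ((pderiv ^^ k) S) has_real_derivative poly (pderiv ((pderiv ^^ k) S)) w) (at w within T)"
        for k S w T by (rule poly_DERIV[THEN has_field_derivative_at_within])
      have "\<tau> ^ m dvd R"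
        by (simp add: R_def \<theta>_def pcompose_mult pcompose_power pcompose_pCons dvd_mult2 dvd_mult)
      then have R0: "poly ((pderiv ^^ k) R) a = 0" if "k < m" for k
        using that ab by (intro jet_vanishes[of \<tau> m R]) (simp_all add: \<tau>_def)
      have 1: "\<bar>poly ((pderiv ^^ i) R) z\<bar> \<le> K * \<beta> / (b - a) ^ m * \<bar>z - a\<bar> ^ (m - i)"
        by (rule iterated_deriv_bound[where R = "\<lambda>k. poly ((pderiv ^^ k) R)" and a = a and b = b])
          (use ab z i in \<open>auto intro: pd R0 Rm\<close>)
      define R2 where "R2 = A + R - B"
      have "R2 = (pcompose \<theta> \<tau> - 1) * Q" by (simp add: R2_def R_def Q_def algebra_simps)
      also have "\<theta> - 1 = - (v * [:1, -1:] ^ m)" using uv by (simp add: \<theta>_def algebra_simps)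
      then have "pcompose \<theta> \<tau> - 1 = pcompose (- (v * [:1, -1:] ^ m)) \<tau>"
        by (metis pcompose_1 pcompose_diff)
      finally have R2: "R2 = pcompose (- (v * [:1, -1:] ^ m)) \<tau> * Q" .
      have R2dvd: "pcompose [:1, -1:] \<tau> ^ m dvd R2"
        unfolding R2 by (simp add: pcompose_mult pcompose_power pcompose_uminus dvd_mult2 dvd_mult)
      have R20: "poly ((pderiv ^^ k) R2) b = 0" if "k < m" for k
      proof (rule jet_vanishes[OF R2dvd])
        have "poly \<tau> b = b / (b - a) - a / (b - a)" by (simp add: \<tau>_def)
        also have "\<dots> = 1" using ab by (simp add: diff_divide_distrib[symmetric])
        finally show "poly (pcompose [:1, -1:] \<tau>) b = 0" by (simp add: poly_pcompose)
      qed (use that in auto)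
      \<comment> \<open>The differences of the interpolant from \<open>A\<close> and from
        \<open>B\<close> therefore have the same m-th derivative, and one bound serves both
        ends.\<close>
      have "degree (A - B) < m" using A B by (intro degree_diff_less)
      then have "(pderiv ^^ m) R2 = (pderiv ^^ m) R"
        using higher_pderiv_add[of m "A - B" R] by (simp add: R2_def higher_pderiv_eq_0 algebra_simps)
      then have R2m: "\<bar>poly ((pderiv ^^ m) R2) w\<bar> \<le> K * \<beta> / (b - a) ^ m" if "w \<in> {a..b}" for w
        using Rm[OF that] by simp
      have 2: "\<bar>poly ((pderiv ^^ i) R2) z\<bar> \<le> K * \<beta> / (b - a) ^ m * \<bar>z - b\<bar> ^ (m - i)"
        by (rule iterated_deriv_bound[where R = "\<lambda>k. poly ((pderiv ^^ k) R2)" and a = a and b = b])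
          (use ab z i in \<open>auto intro: pd R20 R2m\<close>)
      show ?thesis using 1 2 z by (simp add: R2_def)
    qed
    then show "\<exists>H. a < b \<longrightarrow> degree A < m \<longrightarrow> degree B < m \<longrightarrow>
      (\<forall>\<beta> c. c \<in> {a..b} \<longrightarrow> jet_le (b - a) \<beta> (A - B) c \<longrightarrow>
        (\<forall>z\<in>{a..b}. \<forall>i\<le>m. \<bar>poly ((pderiv ^^ i) (H - A)) z\<bar> \<le> K * \<beta> / (b - a) ^ m * (z - a) ^ (m - i) \<and>
          \<bar>poly ((pderiv ^^ i) (H - B)) z\<bar> \<le> K * \<beta> / (b - a) ^ m * (b - z) ^ (m - i)))"
      by (intro exI[of _ "A + R"]) blast
  qed
qed

lemma powr_rate:
  assumes "w \<ge> 0" "d > 0" "i \<le> m"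
  shows "(w / d) powr (1 / p) * d ^ (m - i) = w powr (1 / p) * d powr (real m - real i - 1 / p)"
proof -
  have "d ^ (m - i) = d powr (real m - real i)"
    using assms by (simp add: powr_realpow[symmetric] of_nat_diff)
  then show ?thesis using assms by (simp add: powr_divide powr_diff[of d "real m - real i" "1 / p"])
qed

lemma DERIV_zero_if_powr_bound:
  fixes D :: "real \<Rightarrow> real"
  assumes "D y = 0" "s > 1" and bound: "\<And>z. \<bar>z - y\<bar> < 1 \<Longrightarrow> z \<noteq> y \<Longrightarrow> \<bar>D z\<bar> \<le> C * \<bar>z - y\<bar> powr s"
  shows "(D has_real_derivative 0) (at y)"
  unfolding has_field_derivative_iff
proof (rule Lim_null_comparison)
  show "eventually (\<lambda>z. norm ((D z - D y) / (z - y)) \<le> C * \<bar>z - y\<bar> powr (s - 1)) (at y)"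
    unfolding eventually_at
  proof (intro exI[of _ 1] conjI ballI impI)
    fix z assume "z \<noteq> y \<and> dist z y < 1"
    then have "z \<noteq> y" "\<bar>D z\<bar> \<le> C * \<bar>z - y\<bar> powr s" using bound by (auto simp: dist_real_def)
    then show "norm ((D z - D y) / (z - y)) \<le> C * \<bar>z - y\<bar> powr (s - 1)"
      using assms(1) by (simp add: powr_diff divide_right_mono)
  qed simp
  have "((\<lambda>z. \<bar>z - y\<bar> powr (s - 1)) \<longlongrightarrow> \<bar>y - y\<bar> powr (s - 1)) (at y)"
    using assms(2) by (intro tendsto_powr' tendsto_rabs tendsto_diff tendsto_const tendsto_ident_at) auto
  then show "((\<lambda>z. C * \<bar>z - y\<bar> powr (s - 1)) \<longlongrightarrow> 0) (at y)"
    using tendsto_mult_left[of _ 0 _ C] by simp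
qed

text \<open>Here \<open>E\<close> is unbounded in both directions, so that every gap is bounded. In
  \<open>near\<close> the comparison point may be any \<open>c\<close> between \<open>x\<close> and
  \<open>y\<close>, because on adjoined rays the field is copied from another point.
  \<open>H\<close> and \<open>K\<close> are parameters so that \<open>K\<close> can be fixed before
  \<open>p\<close> and \<open>E\<close>.\<close>

locale whitney_data =
  fixes m :: nat and p :: real and E :: "real set" and P :: "real \<Rightarrow> real poly"
    and W :: "real \<Rightarrow> real" and V K :: real and H :: "real \<Rightarrow> real \<Rightarrow> real poly \<Rightarrow> real poly \<Rightarrow> real poly"
  assumes m: "m \<ge> 1" and p: "p > 1" and E: "closed E"
    and below: "\<And>y. \<exists>e\<in>E. e \<le> y" and above: "\<And>y. \<exists>e\<in>E. y \<le> e"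
    and deg: "\<And>x. x \<in> E \<Longrightarrow> degree (P x) < m"
    and W_mono: "\<And>x y. \<lbrakk>x \<in> E; y \<in> E; x \<le> y\<rbrakk> \<Longrightarrow> W x \<le> W y"
    and W_range: "\<And>x. x \<in> E \<Longrightarrow> 0 \<le> W x \<and> W x \<le> V"
    and near: "\<And>x y. \<lbrakk>x \<in> E; y \<in> E; x < y\<rbrakk> \<Longrightarrow> \<exists>c\<in>{x..y}. \<forall>k<m.
      \<bar>poly ((pderiv ^^ k) (P x - P y)) c\<bar> \<le> (W y - W x) powr (1 / p) * (y - x) powr (real m - real k - 1 / p)"
    and K: "K \<ge> 1"
    and gap: "\<And>a b A B \<beta> c z i. \<lbrakk>a < b; degree A < m; degree B < m; c \<in> {a..b}; jet_le (b - a) \<beta> (A - B) c;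
      z \<in> {a..b}; i \<le> m\<rbrakk> \<Longrightarrow>
      \<bar>poly ((pderiv ^^ i) (H a b A B - A)) z\<bar> \<le> K * \<beta> / (b - a) ^ m * (z - a) ^ (m - i) \<and>
      \<bar>poly ((pderiv ^^ i) (H a b A B - B)) z\<bar> \<le> K * \<beta> / (b - a) ^ m * (b - z) ^ (m - i)"
begin

section \<open>Comparison of the field at two points\<close>

lemma exponent_nonneg: "i < m \<Longrightarrow> 0 \<le> real m - real i - 1 / p"
proof -
  assume "i < m"
  then have "1 \<le> real m - real i" by linarith
  moreover have "1 / p \<le> 1" using p by simp
  ultimately show ?thesis by linarith
qed

text \<open>The weight \<open>h ^ k\<close> turns the exponents
  \<open>real m - real k - 1 / p\<close> into the common exponent \<open>real m - 1 / p\<close>, so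
  the bounds in \<open>near\<close> merge into one jet bound. Nonnegative exponents permit any
  \<open>h\<close> from \<open>y - x\<close> upwards.\<close>

lemma jet_le_near:
  assumes "x \<in> E" "y \<in> E" "x < y" "y - x \<le> h" "W y - W x \<le> S"
  shows "\<exists>c\<in>{x..y}. jet_le h (S powr (1 / p) * h powr (real m - 1 / p)) (P x - P y) c"
proof -
  obtain c where c: "c \<in> {x..y}" "\<forall>k<m.
      \<bar>poly ((pderiv ^^ k) (P x - P y)) c\<bar> \<le> (W y - W x) powr (1 / p) * (y - x) powr (real m - real k - 1 / p)"
    using near[OF assms(1-3)] by blast
  have h: "h > 0" and W: "0 \<le> W y - W x" using assms W_mono[of x y] by auto
  have "\<bar>poly ((pderiv ^^ k) (P x - P y)) c\<bar> * h ^ k \<le> S powr (1 / p) * h powr (real m - 1 / p)" for k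
  proof (cases "k < m")
    case True
    have "\<bar>poly ((pderiv ^^ k) (P x - P y)) c\<bar> \<le> (W y - W x) powr (1 / p) * (y - x) powr (real m - real k - 1 / p)"
      using c True by blast
    also have "\<dots> \<le> S powr (1 / p) * h powr (real m - real k - 1 / p)"
      using assms W p exponent_nonneg[OF True] by (intro mult_mono powr_mono2) auto
    finally have "\<bar>poly ((pderiv ^^ k) (P x - P y)) c\<bar> * h ^ k
        \<le> S powr (1 / p) * h powr (real m - real k - 1 / p) * h ^ k"
      using h by (intro mult_right_mono) auto
    also have "\<dots> = S powr (1 / p) * (h powr (real m - real k - 1 / p) * h powr real k)"
      using h by (simp add: powr_realpow)
    also have "h powr (real m - real k - 1 / p) * h powr real k = h powr (real m - 1 / p)"
      by (simp add: powr_add[symmetric])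
    finally show ?thesis .
  next
    case False
    have "degree (P x - P y) < m" using assms deg by (intro degree_diff_less)
    with False show ?thesis by (simp add: higher_pderiv_eq_0)
  qed
  then show ?thesis using c(1) by (intro bexI[of _ c]) (simp_all add: jet_le_def)
qed

text \<open>The jet bound at \<open>c\<close> is carried to any point of a surrounding interval, at
  the cost of the factor \<open>real m\<close>.\<close>

lemma field_difference:
  assumes xy: "x \<in> E" "y \<in> E" "x \<le> y" and sub: "x' \<le> x" "y \<le> y'" "x' < y'"
    and S: "W y - W x \<le> S" and z: "z \<in> {x'..y'}" and i: "i < m"
  shows "\<bar>poly ((pderiv ^^ i) (P x - P y)) z\<bar>
    \<le> real m * (S powr (1 / p) * (y' - x') powr (real m - real i - 1 / p))"
proof (cases "x = y")
  case False
  let ?h = "y' - x'"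
  have h: "?h > 0" using sub by simp
  obtain c where c: "c \<in> {x..y}" "jet_le ?h (S powr (1 / p) * ?h powr (real m - 1 / p)) (P x - P y) c"
    using jet_le_near[of x y ?h S] False assms by auto
  have "jet_le ?h (real m * (S powr (1 / p) * ?h powr (real m - 1 / p))) (P x - P y) z"
  proof (rule jet_le_shift[OF _ c(2) _ h])
    show "degree (P x - P y) < m" using xy deg by (intro degree_diff_less)
    show "\<bar>z - c\<bar> \<le> ?h" using z c(1) sub by auto
  qed
  then have "\<bar>poly ((pderiv ^^ i) (P x - P y)) z\<bar> * ?h ^ i \<le> real m * (S powr (1 / p) * ?h powr (real m - 1 / p))"
    by (rule jet_leD)
  also have "?h powr (real m - 1 / p) = ?h powr (real m - real i - 1 / p) * ?h ^ i"
    using h by (simp add: powr_realpow[symmetric] powr_add[symmetric])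
  finally show ?thesis using h by simp
qed simp

section \<open>Gaps and their endpoints\<close>

definition lo :: "real \<Rightarrow> real" where "lo y = Sup (E \<inter> {..y})"
definition hi :: "real \<Rightarrow> real" where "hi y = Inf (E \<inter> {y..})"

lemma lo: "lo y \<in> E" "lo y \<le> y"
proof -
  have "lo y \<in> E \<inter> {..y}"
    unfolding lo_def using below[of y] E by (intro closed_contains_Sup) (auto intro: bdd_aboveI closed_Int)
  then show "lo y \<in> E" "lo y \<le> y" by auto
qed

lemma hi: "hi y \<in> E" "y \<le> hi y"
proof -
  have "hi y \<in> E \<inter> {y..}"
    unfolding hi_def using above[of y] E by (intro closed_contains_Inf) (auto intro: bdd_belowI closed_Int)
  then show "hi y \<in> E" "y \<le> hi y" by auto
qed

lemma le_lo: "e \<in> E \<Longrightarrow> e \<le> y \<Longrightarrow> e \<le> lo y"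
  unfolding lo_def by (rule cSup_upper) (auto intro: bdd_aboveI)

lemma hi_le: "e \<in> E \<Longrightarrow> y \<le> e \<Longrightarrow> hi y \<le> e"
  unfolding hi_def by (rule cInf_lower) (auto intro: bdd_belowI)

lemma lo_hi_strict: "y \<notin> E \<Longrightarrow> lo y < y \<and> y < hi y"
  using lo[of y] hi[of y] by (metis less_le)

lemma lo_hi_cong:
  assumes "x \<le> y" "E \<inter> {x..y} = {}"
  shows "lo x = lo y" "hi x = hi y"
proof -
  have "E \<inter> {..x} = E \<inter> {..y}" "E \<inter> {x..} = E \<inter> {y..}" using assms by force+
  then show "lo x = lo y" "hi x = hi y" by (simp_all add: lo_def hi_def)
qed

lemma same_gap:
  assumes "y \<notin> E" "lo y < z" "z < hi y"
  shows "z \<notin> E" "lo z = lo y" "hi z = hi y"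
proof -
  have *: "e \<notin> E" if "lo y < e" "e < hi y" for e
    using that le_lo[of e y] hi_le[of e y] by linarith
  then show "z \<notin> E" using assms by blast
  have "lo z = lo y \<and> hi z = hi y"
  proof (cases "y \<le> z")
    case True
    moreover have "E \<inter> {y..z} = {}" using * assms lo_hi_strict[of y] by auto
    ultimately show ?thesis using lo_hi_cong[of y z] by simp
  next
    case False
    moreover have "E \<inter> {z..y} = {}" using * assms lo_hi_strict[of y] by auto
    ultimately show ?thesis using lo_hi_cong[of z y] by simp
  qed
  then show "lo z = lo y" "hi z = hi y" by simp_all
qed

section \<open>Extension of the control function and of the field across the gaps\<close>

definition slope :: "real \<Rightarrow> real" where
  "slope y = (W (hi y) - W (lo y)) / (hi y - lo y)"

definition ext_W :: "real \<Rightarrow> real" where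
  "ext_W y = (if y \<in> E then W y else W (lo y) + slope y * (y - lo y))"

definition ext_P :: "real \<Rightarrow> real poly" where
  "ext_P y = (if y \<in> E then P y else H (lo y) (hi y) (P (lo y)) (P (hi y)))"

text \<open>The candidate for the i-th derivative of the extension \<open>f 0\<close>. On
  \<open>E\<close> it is the prescribed value; that these functions are successive derivatives is
  proved separately off \<open>E\<close> and, below the top order, on \<open>E\<close>.\<close>

definition f :: "nat \<Rightarrow> real \<Rightarrow> real" where
  "f i y = poly ((pderiv ^^ i) (ext_P y)) y"

lemma slope_nonneg: "0 \<le> slope y"
  unfolding slope_def using lo[of y] hi[of y] by (intro divide_nonneg_nonneg) (auto intro: W_mono)

lemma ext_W_lo: "y \<notin> E \<Longrightarrow> ext_W y - W (lo y) = slope y * (y - lo y)"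
  by (simp add: ext_W_def)

lemma ext_W_hi: "y \<notin> E \<Longrightarrow> W (hi y) - ext_W y = slope y * (hi y - y)"
proof -
  assume y: "y \<notin> E"
  have "W (hi y) - W (lo y) = slope y * (hi y - lo y)"
    using lo_hi_strict[OF y] by (simp add: slope_def)
  then show ?thesis using y by (simp add: ext_W_def algebra_simps)
qed

lemma ext_W_gap: "y \<notin> E \<Longrightarrow> W (lo y) \<le> ext_W y \<and> ext_W y \<le> W (hi y)"
  using ext_W_lo[of y] ext_W_hi[of y] lo_hi_strict[of y] slope_nonneg[of y]
    mult_nonneg_nonneg[of "slope y" "y - lo y"] mult_nonneg_nonneg[of "slope y" "hi y - y"] by linarith

lemma ext_W_ge: "e \<in> E \<Longrightarrow> e \<le> y \<Longrightarrow> W e \<le> ext_W y"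
  using ext_W_gap[of y] W_mono[of e "lo y"] W_mono[of e y] le_lo[of e y] lo[of y]
  by (cases "y \<in> E") (auto simp: ext_W_def)

lemma ext_W_le: "e \<in> E \<Longrightarrow> y \<le> e \<Longrightarrow> ext_W y \<le> W e"
  using ext_W_gap[of y] W_mono[of "hi y" e] W_mono[of y e] hi_le[of e y] hi[of y]
  by (cases "y \<in> E") (auto simp: ext_W_def)

lemma ext_W_same_gap:
  assumes "x \<le> y" "E \<inter> {x..y} = {}"
  shows "ext_W y - ext_W x = slope y * (y - x)"
proof -
  have "x \<notin> E" "y \<notin> E" using assms by auto
  moreover have "slope x = slope y" using lo_hi_cong[OF assms] by (simp add: slope_def)
  ultimately show ?thesis using lo_hi_cong[OF assms] by (simp add: ext_W_def algebra_simps)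
qed

lemma mono_ext_W: "mono ext_W"
proof (rule monoI)
  fix x y :: real assume xy: "x \<le> y"
  show "ext_W x \<le> ext_W y"
  proof (cases "E \<inter> {x..y} = {}")
    case True
    then show ?thesis
      using ext_W_same_gap[OF xy True] mult_nonneg_nonneg[OF slope_nonneg, of "y - x" y] xy by linarith
  next
    case False
    then obtain e where "e \<in> E" "x \<le> e" "e \<le> y" by auto
    then show ?thesis using ext_W_le[of e x] ext_W_ge[of e y] by linarith
  qed
qed

lemma ext_W_range: "0 \<le> ext_W y \<and> ext_W y \<le> V"
  using ext_W_ge[OF lo, of y] ext_W_le[OF hi, of y] W_range[OF lo(1), of y] W_range[OF hi(1), of y] by linarith

text \<open>For the jet bound of the two end polynomials, the quotient
  \<beta>\<open>/ (b - a) ^ m\<close> is exactly the p-th root of the slope. As \<open>ext_W\<close>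
  has this same slope on every part of the gap, the estimate can be read with the increment of
  \<open>ext_W\<close> between an end and \<open>y\<close>.\<close>

lemma gap_bounds:
  assumes y: "y \<notin> E" and z: "z \<in> {lo y..hi y}" and i: "i \<le> m"
  shows "\<bar>poly ((pderiv ^^ i) (ext_P y - P (lo y))) z\<bar> \<le> K * (slope y powr (1 / p) * (z - lo y) ^ (m - i))"
    "\<bar>poly ((pderiv ^^ i) (ext_P y - P (hi y))) z\<bar> \<le> K * (slope y powr (1 / p) * (hi y - z) ^ (m - i))"
proof -
  let ?h = "hi y - lo y" and ?w = "W (hi y) - W (lo y)"
  have lh: "lo y < hi y" using lo_hi_strict[OF y] by linarith
  have w: "0 \<le> ?w" using W_mono[OF lo(1) hi(1), of y y] lh by simp
  obtain c where c: "c \<in> {lo y..hi y}" "jet_le ?h (?w powr (1 / p) * ?h powr (real m - 1 / p)) (P (lo y) - P (hi y)) c"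
    using jet_le_near[OF lo(1) hi(1) lh order_refl order_refl] by blast
  have "?w powr (1 / p) * ?h powr (real m - 1 / p) = slope y powr (1 / p) * ?h ^ m"
    using powr_rate[OF w, of ?h 0 m p] lh by (simp add: slope_def)
  then have "K * (?w powr (1 / p) * ?h powr (real m - 1 / p)) / ?h ^ m = K * slope y powr (1 / p)"
    using lh by simp
  with gap[OF lh deg[OF lo(1)] deg[OF hi(1)] c z i] y
  show "\<bar>poly ((pderiv ^^ i) (ext_P y - P (lo y))) z\<bar> \<le> K * (slope y powr (1 / p) * (z - lo y) ^ (m - i))"
    "\<bar>poly ((pderiv ^^ i) (ext_P y - P (hi y))) z\<bar> \<le> K * (slope y powr (1 / p) * (hi y - z) ^ (m - i))"
    by (auto simp: ext_P_def mult.assoc)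
qed

text \<open>For \<open>i = m - 1\<close> its p-th power is the right side of the increment condition
  with control function \<open>ext_W\<close>; lower orders gain powers of
  \<open>y - x\<close>.\<close>

definition rate :: "nat \<Rightarrow> real \<Rightarrow> real \<Rightarrow> real" where
  "rate i x y = (ext_W y - ext_W x) powr (1 / p) * (y - x) powr (real m - real i - 1 / p)"

lemma rate_nonneg: "0 \<le> rate i x y"
  by (simp add: rate_def)

lemma rate_mono:
  assumes "x' \<le> x" "x \<le> y" "y \<le> y'" "i < m"
  shows "rate i x y \<le> rate i x' y'"
proof -
  have "ext_W x' \<le> ext_W x" "ext_W x \<le> ext_W y" "ext_W y \<le> ext_W y'"
    using assms mono_ext_W by (auto simp: mono_def)
  then show ?thesis
    unfolding rate_def using assms p exponent_nonneg[OF assms(4)] by (intro mult_mono powr_mono2) auto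
qed

lemma ext_W_on_E: "e \<in> E \<Longrightarrow> ext_W e = W e"
  by (simp add: ext_W_def)

text \<open>In a gap the comparison goes through its left end: \<open>K\<close> pays for the
  interpolant against \<open>P (lo y)\<close>, and \<open>real m\<close> for \<open>P (lo y)\<close>
  against \<open>P e\<close>.\<close>

lemma taylor_estimate_right:
  assumes e: "e \<in> E" and ey: "e < y" and i: "i < m"
  shows "\<bar>f i y - poly ((pderiv ^^ i) (P e)) y\<bar> \<le> (K + real m) * rate i e y"
proof (cases "y \<in> E")
  case True
  have "\<bar>poly ((pderiv ^^ i) (P e - P y)) y\<bar> \<le> real m * rate i e y"
    unfolding rate_def ext_W_on_E[OF e] ext_W_on_E[OF True]
    using e True ey i by (intro field_difference) auto
  also have "\<dots> \<le> (K + real m) * rate i e y"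
    using K rate_nonneg by (intro mult_right_mono) auto
  finally show ?thesis using True by (simp add: f_def ext_P_def higher_pderiv_diff abs_minus_commute)
next
  case False
  have l: "lo y < y" "e \<le> lo y" using lo_hi_strict[OF False] le_lo[OF e, of y] ey by auto
  have "\<bar>poly ((pderiv ^^ i) (ext_P y - P (lo y))) y\<bar> \<le> K * (slope y powr (1 / p) * (y - lo y) ^ (m - i))"
    using False i lo_hi_strict[OF False] by (intro gap_bounds) auto
  also have "slope y = (ext_W y - ext_W (lo y)) / (y - lo y)"
    using l ext_W_lo[OF False] by (simp add: ext_W_on_E lo)
  also have "\<dots> powr (1 / p) * (y - lo y) ^ (m - i) = rate i (lo y) y"
    unfolding rate_def using l i mono_ext_W by (intro powr_rate) (auto simp: mono_def)
  also have "rate i (lo y) y \<le> rate i e y" using l i by (intro rate_mono) auto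
  finally have 1: "\<bar>poly ((pderiv ^^ i) (ext_P y - P (lo y))) y\<bar> \<le> K * rate i e y" using K by simp
  have 2: "\<bar>poly ((pderiv ^^ i) (P e - P (lo y))) y\<bar> \<le> real m * rate i e y"
    unfolding rate_def ext_W_on_E[OF e]
    using e l i ey ext_W_ge[OF lo, of y] by (intro field_difference) (auto simp: lo)
  show ?thesis using 1 2 by (simp add: f_def higher_pderiv_diff algebra_simps)
qed

lemma taylor_estimate_left:
  assumes e: "e \<in> E" and ey: "y < e" and i: "i < m"
  shows "\<bar>f i y - poly ((pderiv ^^ i) (P e)) y\<bar> \<le> (K + real m) * rate i y e"
proof (cases "y \<in> E")
  case True
  have "\<bar>poly ((pderiv ^^ i) (P y - P e)) y\<bar> \<le> real m * rate i y e"
    unfolding rate_def ext_W_on_E[OF e] ext_W_on_E[OF True]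
    using e True ey i by (intro field_difference) auto
  also have "\<dots> \<le> (K + real m) * rate i y e"
    using K rate_nonneg by (intro mult_right_mono) auto
  finally show ?thesis using True by (simp add: f_def ext_P_def higher_pderiv_diff)
next
  case False
  have l: "y < hi y" "hi y \<le> e" using lo_hi_strict[OF False] hi_le[OF e, of y] ey by auto
  have "\<bar>poly ((pderiv ^^ i) (ext_P y - P (hi y))) y\<bar> \<le> K * (slope y powr (1 / p) * (hi y - y) ^ (m - i))"
    using False i lo_hi_strict[OF False] by (intro gap_bounds) auto
  also have "slope y = (ext_W (hi y) - ext_W y) / (hi y - y)"
    using l ext_W_hi[OF False] by (simp add: ext_W_on_E hi)
  also have "\<dots> powr (1 / p) * (hi y - y) ^ (m - i) = rate i y (hi y)"
    unfolding rate_def using l i mono_ext_W by (intro powr_rate) (auto simp: mono_def)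
  also have "rate i y (hi y) \<le> rate i y e" using l i by (intro rate_mono) auto
  finally have 1: "\<bar>poly ((pderiv ^^ i) (ext_P y - P (hi y))) y\<bar> \<le> K * rate i y e" using K by simp
  have 2: "\<bar>poly ((pderiv ^^ i) (P (hi y) - P e)) y\<bar> \<le> real m * rate i y e"
    unfolding rate_def ext_W_on_E[OF e]
    using e l i ey ext_W_le[OF hi, of y] by (intro field_difference) (auto simp: hi)
  show ?thesis using 1 2 by (simp add: f_def higher_pderiv_diff algebra_simps)
qed

lemma f_deriv_off_E:
  assumes "y \<notin> E"
  shows "(f i has_real_derivative f (Suc i) y) (at y)"
proof -
  let ?S = "{lo y<..<hi y}"
  have "(poly ((pderiv ^^ i) (ext_P y)) has_real_derivative poly (pderiv ((pderiv ^^ i) (ext_P y))) y) (at y)"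
    by (rule poly_DERIV)
  then show ?thesis
    unfolding f_def funpow.simps comp_apply
  proof (rule has_field_derivative_transform_within_open[of _ _ _ ?S])
    show "y \<in> ?S" using lo_hi_strict[OF assms] by simp
    show "poly ((pderiv ^^ i) (ext_P y)) z = poly ((pderiv ^^ i) (ext_P z)) z" if "z \<in> ?S" for z
      using same_gap[OF assms, of z] that assms by (simp add: ext_P_def)
  qed simp
qed

lemma f_deriv_on_E:
  assumes y: "y \<in> E" and i: "Suc i < m"
  shows "(f i has_real_derivative f (Suc i) y) (at y)"
proof -
  define D where "D z = f i z - poly ((pderiv ^^ i) (P y)) z" for z
  have i': "i < m" using i by simp
  \<comment> \<open>Since \<open>i + 2 \<le> m\<close>, the remainder at \<open>y\<close> has order
    at least \<open>2 - 1 / p\<close>, which exceeds 1, so its derivative is 0. At order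
    \<open>m - 1\<close> the exponent drops below 1, and only increments are estimated
    there.\<close>
  have s: "1 < 2 - 1 / p" using p by simp
  have rate_le: "rate i u v \<le> V powr (1 / p) * (v - u) powr (2 - 1 / p)" if "u < v" "v - u < 1" for u v
    unfolding rate_def
  proof (rule mult_mono)
    show "(ext_W v - ext_W u) powr (1 / p) \<le> V powr (1 / p)"
      using ext_W_range[of u] ext_W_range[of v] mono_ext_W that p
      by (intro powr_mono2) (auto simp: mono_def)
    have "2 \<le> real m - real i" using i by linarith
    then show "(v - u) powr (real m - real i - 1 / p) \<le> (v - u) powr (2 - 1 / p)"
      using that by (intro powr_mono') auto
  qed auto
  have "(D has_real_derivative 0) (at y)"
  proof (rule DERIV_zero_if_powr_bound[OF _ s])
    show "D y = 0" using y by (simp add: D_def f_def ext_P_def)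
    show "\<bar>D z\<bar> \<le> (K + real m) * V powr (1 / p) * \<bar>z - y\<bar> powr (2 - 1 / p)"
      if z: "\<bar>z - y\<bar> < 1" "z \<noteq> y" for z
    proof (cases "y < z")
      case True
      have "\<bar>D z\<bar> \<le> (K + real m) * rate i y z"
        unfolding D_def by (rule taylor_estimate_right[OF y True i'])
      also have "\<dots> \<le> (K + real m) * (V powr (1 / p) * (z - y) powr (2 - 1 / p))"
        using rate_le[of y z] z True K by (intro mult_left_mono) auto
      finally show ?thesis using True by (simp add: mult_ac)
    next
      case False
      then have zy: "z < y" using z by simp
      have "\<bar>D z\<bar> \<le> (K + real m) * rate i z y"
        unfolding D_def by (rule taylor_estimate_left[OF y zy i'])
      also have "\<dots> \<le> (K + real m) * (V powr (1 / p) * (y - z) powr (2 - 1 / p))"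
        using rate_le[of z y] z zy K by (intro mult_left_mono) auto
      finally show ?thesis using zy by (simp add: mult_ac)
    qed
  qed
  from DERIV_add[OF this poly_DERIV[of "(pderiv ^^ i) (P y)" y]]
  have "((\<lambda>z. D z + poly ((pderiv ^^ i) (P y)) z) has_real_derivative f (Suc i) y) (at y)"
    using y by (simp add: f_def ext_P_def)
  then show ?thesis by (simp add: D_def)
qed

lemma f_deriv: "Suc i < m \<Longrightarrow> (f i has_real_derivative f (Suc i) y) (at y)"
  using f_deriv_on_E f_deriv_off_E by blast

text \<open>With no point of \<open>E\<close> between them, \<open>x\<close> and \<open>y\<close>
  share one gap polynomial and its m-th derivative is bounded. Otherwise both values are compared
  with the polynomial at a point \<open>e\<close> between them, whence the factor 2.\<close>

lemma top_increment_le_rate: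
  assumes xy: "x < y"
  shows "\<bar>f (m - 1) y - f (m - 1) x\<bar> \<le> 2 * (K + real m) * rate (m - 1) x y"
proof (cases "E \<inter> {x..y} = {}")
  case True
  then have xE: "x \<notin> E" and yE: "y \<notin> E" using xy by auto
  note c = lo_hi_cong[OF less_imp_le[OF xy] True]
  have PP: "ext_P x = ext_P y" using c xE yE by (simp add: ext_P_def)
  have sub: "{x..y} \<subseteq> {lo y..hi y}" using lo_hi_strict[OF xE] lo_hi_strict[OF yE] c by auto
  let ?Q = "(pderiv ^^ (m - 1)) (ext_P y)"
  have dQ: "pderiv ((pderiv ^^ (m - Suc 0)) (ext_P y)) = (pderiv ^^ m) (ext_P y)" using m by (cases m) auto
  have "norm (poly ?Q y - poly ?Q x) \<le> K * slope y powr (1 / p) * norm (y - x)"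
  proof (rule field_differentiable_bound[of "{x..y}"])
    show "(poly ?Q has_field_derivative poly (pderiv ?Q) w) (at w within {x..y})" for w
      by (rule poly_DERIV[THEN has_field_derivative_at_within])
    \<comment> \<open>\<open>P (lo y)\<close> has degree below \<open>m\<close>, so the case
      \<open>i = m\<close> of the gap bounds concerns the interpolant alone.\<close>
    show "norm (poly (pderiv ?Q) w) \<le> K * slope y powr (1 / p)" if "w \<in> {x..y}" for w
      using gap_bounds(1)[OF yE, of w m] sub that deg[OF lo(1), of y]
      by (auto simp: dQ higher_pderiv_diff higher_pderiv_eq_0)
  qed (use xy in auto)
  then have "\<bar>f (m - 1) y - f (m - 1) x\<bar> \<le> K * (slope y powr (1 / p) * (y - x) ^ (m - (m - 1)))"
    using xy m by (simp add: f_def PP)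
  also have "slope y = (ext_W y - ext_W x) / (y - x)"
    using ext_W_same_gap[OF less_imp_le[OF xy] True] xy by simp
  also have "\<dots> powr (1 / p) * (y - x) ^ (m - (m - 1)) = rate (m - 1) x y"
    unfolding rate_def using xy mono_ext_W by (intro powr_rate) (auto simp: mono_def)
  also have "K * rate (m - 1) x y \<le> 2 * (K + real m) * rate (m - 1) x y"
    using K rate_nonneg by (intro mult_right_mono) auto
  finally show ?thesis .
next
  case False
  then obtain e where e: "e \<in> E" "x \<le> e" "e \<le> y" by auto
  have m1: "m - 1 < m" using m by simp
  have "degree ((pderiv ^^ (m - 1)) (P e)) = 0"
    using deg[OF e(1)] by (simp add: degree_higher_pderiv)
  then have const: "poly ((pderiv ^^ (m - 1)) (P e)) x = poly ((pderiv ^^ (m - 1)) (P e)) y"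
    by (rule poly_const_if_degree_0)
  have KR: "0 \<le> (K + real m) * rate (m - 1) x y" using K rate_nonneg by simp
  have "\<bar>f (m - 1) x - poly ((pderiv ^^ (m - 1)) (P e)) x\<bar> \<le> (K + real m) * rate (m - 1) x y"
  proof (cases "x = e")
    case False
    then have "\<bar>f (m - 1) x - poly ((pderiv ^^ (m - 1)) (P e)) x\<bar> \<le> (K + real m) * rate (m - 1) x e"
      using e by (intro taylor_estimate_left[OF _ _ m1]) auto
    also have "\<dots> \<le> (K + real m) * rate (m - 1) x y"
      using K e m1 by (intro mult_left_mono rate_mono) auto
    finally show ?thesis .
  qed (use e KR in \<open>simp add: f_def ext_P_def\<close>)
  moreover have "\<bar>f (m - 1) y - poly ((pderiv ^^ (m - 1)) (P e)) y\<bar> \<le> (K + real m) * rate (m - 1) x y"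
  proof (cases "y = e")
    case False
    then have "\<bar>f (m - 1) y - poly ((pderiv ^^ (m - 1)) (P e)) y\<bar> \<le> (K + real m) * rate (m - 1) e y"
      using e by (intro taylor_estimate_right[OF _ _ m1]) auto
    also have "\<dots> \<le> (K + real m) * rate (m - 1) x y"
      using K e m1 by (intro mult_left_mono rate_mono) auto
    finally show ?thesis .
  qed (use e KR in \<open>simp add: f_def ext_P_def\<close>)
  moreover have "2 * (K + real m) * rate (m - 1) x y = (K + real m) * rate (m - 1) x y + (K + real m) * rate (m - 1) x y"
    by simp
  ultimately show ?thesis using const by linarith
qed

lemma higher_deriv_f: "i < m \<Longrightarrow> (deriv ^^ i) (f 0) = f i"
proof (induction i)
  case (Suc i)
  then have "deriv (f i) = f (Suc i)" by (intro ext DERIV_imp_deriv f_deriv)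
  with Suc show ?case by simp
qed simp

lemma extension:
  shows "C_diff (m - 1) (f 0)" "f 0 \<in> sobolev m p" "\<And>x. x \<in> E \<Longrightarrow> taylor_poly (m - 1) x (f 0) = P x"
    "sobolev_seminorm m p (f 0) \<le> 2 * (K + real m) * V powr (1 / p)"
proof -
  let ?C = "2 * (K + real m)"
  define G where "G = f (m - 1)"
  \<comment> \<open>The scaling gives the increment condition with constant 1; the p-th root in the
    norm turns the factor back into \<open>?C\<close>.\<close>
  define W' where "W' x = ?C powr p * ext_W x" for x
  have C: "?C > 0" using K by simp
  have V: "V \<ge> 0" using ext_W_range[of 0] by linarith
  have W': "mono W'"
    using mono_ext_W by (auto simp: mono_def W'_def intro!: mult_left_mono)
  have range': "0 \<le> W' x \<and> W' x \<le> ?C powr p * V" for x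
    using ext_W_range[of x] by (auto simp: W'_def intro!: mult_left_mono)
  have le: "\<bar>G y - G x\<bar> powr p \<le> (W' y - W' x) * (y - x) powr (p - 1)" if "x < y" for x y
  proof -
    have "\<bar>G y - G x\<bar> powr p \<le> (?C * rate (m - 1) x y) powr p"
      unfolding G_def using top_increment_le_rate[OF that] p by (intro powr_mono2) auto
    also have "\<dots> = ?C powr p * ((ext_W y - ext_W x) * (y - x) powr (p - 1))"
    proof -
      have "rate (m - 1) x y = (ext_W y - ext_W x) powr (1 / p) * (y - x) powr (1 - 1 / p)"
        using m by (simp add: rate_def of_nat_diff)
      moreover have "(1 - 1 / p) * p = p - 1" using p by (simp add: left_diff_distrib)
      moreover have "0 \<le> ext_W y - ext_W x" using mono_ext_W that by (simp add: mono_def)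
      ultimately show ?thesis using C p that by (simp add: powr_mult powr_powr)
    qed
    also have "\<dots> = (W' y - W' x) * (y - x) powr (p - 1)" by (simp add: W'_def algebra_simps)
    finally show ?thesis .
  qed
  have dG: "(deriv ^^ (m - 1)) (f 0) = G" using m by (simp add: G_def higher_deriv_f)
  have dm: "(deriv ^^ m) (f 0) = deriv G" using m dG by (cases m) auto
  have hd: "has_derivs (m - 1) (f 0)"
    unfolding has_derivs_def
  proof (intro allI impI)
    fix k x assume "k < m - 1"
    then have "Suc k < m" by simp
    then show "(deriv ^^ k) (f 0) differentiable (at x)"
      using f_deriv[of k x] by (auto simp: higher_deriv_f real_differentiable_def)
  qed
  then show "C_diff (m - 1) (f 0)"
    using Riesz_continuous[OF p W' le] unfolding C_diff_def dG by blast
  have "{x. \<not> G differentiable (at x)} \<in> null_sets lebesgue"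
    using Riesz_differentiable_AE[OF p W' le] by (simp add: negligible_iff_null_sets)
  then have "AE x in lebesgue. G differentiable (at x)" by (rule AE_I') auto
  then show "f 0 \<in> sobolev m p"
    using hd Riesz_abs_cont[OF p W' le] Riesz_deriv_Lp(1)[OF p W' range' le]
    unfolding sobolev_def mem_Collect_eq dG dm by blast
  show "taylor_poly (m - 1) x (f 0) = P x" if x: "x \<in> E" for x
  proof (rule poly_eq_if_jets_eq[where n = m and x = x])
    show "degree (taylor_poly (m - 1) x (f 0)) < m"
      using degree_taylor_poly[of "m - 1" x "f 0"] m by linarith
    show "poly ((pderiv ^^ k) (taylor_poly (m - 1) x (f 0))) x = poly ((pderiv ^^ k) (P x)) x" if "k < m" for k
    proof -
      have "k \<le> m - 1" using that by linarith
      then show ?thesis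
        using that x by (simp add: poly_higher_pderiv_taylor_poly higher_deriv_f f_def ext_P_def)
    qed
  qed (rule deg[OF x])
  have "sobolev_seminorm m p (f 0) \<le> (?C powr p * V) powr (1 / p)"
    unfolding sobolev_seminorm_def Lp_norm_def dm
    using Riesz_deriv_Lp(2)[OF p W' range' le] p by (intro powr_mono2 integral_nonneg_AE) auto
  also have "\<dots> = ?C * V powr (1 / p)"
    using C V p by (simp add: powr_mult powr_powr)
  finally show "sobolev_seminorm m p (f 0) \<le> ?C * V powr (1 / p)" .
qed

end

section \<open>Variation of the field\<close>

definition jet_term :: "nat \<Rightarrow> real \<Rightarrow> (real \<Rightarrow> real poly) \<Rightarrow> real \<Rightarrow> real \<Rightarrow> real" where
  "jet_term m p P x y = (\<Sum>i=0..m-1. \<bar>poly ((pderiv ^^ i) (P x)) x - poly ((pderiv ^^ i) (P y)) x\<bar> powr p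
    / (y - x) powr ((real m - real i) * p - 1))"

definition chain :: "real set \<Rightarrow> nat \<Rightarrow> (nat \<Rightarrow> real) \<Rightarrow> bool" where
  "chain E k s \<longleftrightarrow> 1 \<le> k \<and> strict_mono_on {1..k} s \<and> s ` {1..k} \<subseteq> E"

definition chain_sum :: "nat \<Rightarrow> real \<Rightarrow> (real \<Rightarrow> real poly) \<Rightarrow> nat \<Rightarrow> (nat \<Rightarrow> real) \<Rightarrow> real" where
  "chain_sum m p P k s = (\<Sum>j=1..k-1. jet_term m p P (s j) (s (j + 1)))"

definition variation_upto :: "nat \<Rightarrow> real \<Rightarrow> real set \<Rightarrow> (real \<Rightarrow> real poly) \<Rightarrow> real \<Rightarrow> real" where
  "variation_upto m p E P x = Sup {chain_sum m p P k s | k s. chain (E \<inter> {..x}) k s}"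

lemma jet_term_nonneg: "0 \<le> jet_term m p P x y"
  unfolding jet_term_def by (intro sum_nonneg) auto

lemma chain_subset: "chain A k s \<Longrightarrow> A \<subseteq> B \<Longrightarrow> chain B k s"
  by (auto simp: chain_def)

lemma chain_append:
  assumes c: "chain (E \<inter> {..x}) k s" and y: "s k < y" "y \<in> E" "x \<le> y"
  shows "chain (E \<inter> {..y}) (Suc k) (s(Suc k := y))"
    "chain_sum m p P (Suc k) (s(Suc k := y)) = chain_sum m p P k s + jet_term m p P (s k) y"
proof -
  let ?s = "s(Suc k := y)"
  have k: "1 \<le> k" and mono: "strict_mono_on {1..k} s" and im: "s ` {1..k} \<subseteq> E \<inter> {..x}"
    using c by (auto simp: chain_def)
  have le: "s i \<le> s k" if "i \<in> {1..k}" for i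
    using strict_mono_on_leD[OF mono that, of k] that k by auto
  have "strict_mono_on {1..Suc k} ?s"
  proof (rule strict_mono_onI)
    fix i j assume ij: "i \<in> {1..Suc k}" "j \<in> {1..Suc k}" "i < j"
    show "?s i < ?s j"
    proof (cases "j = Suc k")
      case True
      then have "s i \<le> s k" using ij by (intro le) auto
      then show ?thesis using True ij y by simp
    next
      case False
      then have "i \<in> {1..k}" "j \<in> {1..k}" using ij by auto
      then show ?thesis using mono ij False by (auto simp: strict_mono_on_def)
    qed
  qed
  moreover have "?s ` {1..Suc k} \<subseteq> E \<inter> {..y}"
  proof
    fix z assume "z \<in> ?s ` {1..Suc k}"
    then obtain i where i: "i \<in> {1..Suc k}" "z = ?s i" by blast
    show "z \<in> E \<inter> {..y}"
    proof (cases "i = Suc k")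
      case False
      then have "s i \<in> E \<inter> {..x}" using i im by (intro subsetD[OF im] imageI) auto
      then show ?thesis using i False y by auto
    qed (use i y in auto)
  qed
  ultimately show "chain (E \<inter> {..y}) (Suc k) ?s" by (simp add: chain_def)
  obtain n where n: "k = Suc n" using k by (cases k) auto
  have "(\<Sum>j=1..n. jet_term m p P (?s j) (?s (j + 1))) = (\<Sum>j=1..n. jet_term m p P (s j) (s (j + 1)))"
    by (rule sum.cong) (auto simp: n)
  then show "chain_sum m p P (Suc k) ?s = chain_sum m p P k s + jet_term m p P (s k) y"
    by (simp add: chain_sum_def n)
qed

lemma chain_sum_le:
  assumes N: "variation_quantity m p E P \<le> ennreal N" "N \<ge> 0" and p: "p > 1" and c: "chain E k s"
  shows "0 \<le> chain_sum m p P k s" "chain_sum m p P k s \<le> N powr p"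
proof -
  show nn: "0 \<le> chain_sum m p P k s"
    unfolding chain_sum_def by (intro sum_nonneg jet_term_nonneg)
  show "chain_sum m p P k s \<le> N powr p"
  proof (cases "k = 1")
    case True
    then show ?thesis by (simp add: chain_sum_def)
  next
    case False
    then have k: "k > 1" "strict_mono_on {1..k} s" "s ` {1..k} \<subseteq> E" using c by (auto simp: chain_def)
    have "ennreal (chain_sum m p P k s powr (1 / p)) \<le> variation_quantity m p E P"
      unfolding variation_quantity_def chain_sum_def jet_term_def
      by (rule Sup_upper) (use k in blast)
    also note N(1)
    finally have "chain_sum m p P k s powr (1 / p) \<le> N" using N(2) by (simp add: ennreal_le_iff)
    then have "(chain_sum m p P k s powr (1 / p)) powr p \<le> N powr p" using p by (intro powr_mono2) auto
    then show ?thesis using p nn by (simp add: powr_powr)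
  qed
qed

lemma variation_upto_range:
  assumes "variation_quantity m p E P \<le> ennreal N" "N \<ge> 0" "p > 1" "x \<in> E"
  shows "bdd_above {chain_sum m p P k s | k s. chain (E \<inter> {..x}) k s}"
    "0 \<le> variation_upto m p E P x" "variation_upto m p E P x \<le> N powr p"
proof -
  let ?A = "{chain_sum m p P k s | k s. chain (E \<inter> {..x}) k s}"
  have le: "0 \<le> a \<and> a \<le> N powr p" if "a \<in> ?A" for a
    using that chain_sum_le[OF assms(1-3)] chain_subset[of "E \<inter> {..x}" _ _ E] by blast
  show bdd: "bdd_above ?A" by (rule bdd_aboveI[of _ "N powr p"]) (use le in blast)
  have "chain (E \<inter> {..x}) 1 (\<lambda>_. x)" using assms(4) by (auto simp: chain_def strict_mono_on_def)
  then have ne: "?A \<noteq> {}" by blast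
  then obtain a where "a \<in> ?A" by blast
  then show "0 \<le> variation_upto m p E P x"
    unfolding variation_upto_def using le cSup_upper[OF _ bdd, of a] by force
  show "variation_upto m p E P x \<le> N powr p"
    unfolding variation_upto_def using ne le by (intro cSup_least) blast+
qed

text \<open>If the chain does not end in \<open>x\<close>, appending \<open>x\<close> first only increases its sum.\<close>

lemma variation_upto_step:
  assumes N: "variation_quantity m p E P \<le> ennreal N" "N \<ge> 0" "p > 1"
    and xy: "x \<in> E" "y \<in> E" "x < y"
  shows "variation_upto m p E P x + jet_term m p P x y \<le> variation_upto m p E P y"
proof -
  let ?A = "{chain_sum m p P k s | k s. chain (E \<inter> {..x}) k s}"
  have up: "chain_sum m p P k s \<le> variation_upto m p E P y" if "chain (E \<inter> {..y}) k s" for k s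
    unfolding variation_upto_def
    using that by (intro cSup_upper variation_upto_range(1)[OF N xy(2)]) blast
  have "chain (E \<inter> {..x}) 1 (\<lambda>_. x)" using xy by (auto simp: chain_def strict_mono_on_def)
  then have ne: "?A \<noteq> {}" by blast
  have "a \<le> variation_upto m p E P y - jet_term m p P x y" if a: "a \<in> ?A" for a
  proof -
    obtain k s where ks: "a = chain_sum m p P k s" "chain (E \<inter> {..x}) k s" using a by blast
    have "s k \<in> s ` {1..k}" using ks(2) by (auto simp: chain_def)
    moreover have "s ` {1..k} \<subseteq> E \<inter> {..x}" using ks(2) by (simp add: chain_def)
    ultimately have "s k \<le> x" by blast
    show ?thesis
    proof (cases "s k = x")
      case True
      then show ?thesis
        using up[OF chain_append(1)[OF ks(2), of y]] chain_append(2)[OF ks(2), of y m p P] xy ks(1) by simp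
    next
      case False
      then have "s k < x" using \<open>s k \<le> x\<close> by simp
      note c = chain_append[OF ks(2) this xy(1) order_refl]
      define s' where "s' = s(Suc k := x)"
      have s': "s' (Suc k) = x" "chain (E \<inter> {..x}) (Suc k) s'"
        "chain_sum m p P (Suc k) s' = a + jet_term m p P (s k) x"
        using c by (simp_all add: s'_def ks(1))
      then have "chain (E \<inter> {..y}) (Suc (Suc k)) (s'(Suc (Suc k) := y))"
        "chain_sum m p P (Suc (Suc k)) (s'(Suc (Suc k) := y)) = chain_sum m p P (Suc k) s' + jet_term m p P x y"
        using chain_append[of E x "Suc k" s' y] xy by simp_all
      with s'(3) up[of "Suc (Suc k)" "s'(Suc (Suc k) := y)"] jet_term_nonneg[of m p P "s k" x]
      show ?thesis by linarith
    qed
  qed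
  then have "variation_upto m p E P x \<le> variation_upto m p E P y - jet_term m p P x y"
    unfolding variation_upto_def[of m p E P x] using ne by (intro cSup_least) blast+
  then show ?thesis by simp
qed

text \<open>A single summand is at most \<open>w\<close>; its p-th root turns the exponent
  \<open>(real m - real k) * p - 1\<close> into \<open>real m - real k - 1 / p\<close>.\<close>

lemma jet_difference_le:
  assumes p: "p > 1" and k: "k < m" and "x < y" and w: "jet_term m p P x y \<le> w"
  shows "\<bar>poly ((pderiv ^^ k) (P x - P y)) x\<bar> \<le> w powr (1 / p) * (y - x) powr (real m - real k - 1 / p)"
proof -
  let ?d = "\<bar>poly ((pderiv ^^ k) (P x - P y)) x\<bar>" and ?h = "y - x"
  have "?d powr p / ?h powr ((real m - real k) * p - 1) \<le> jet_term m p P x y"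
    unfolding jet_term_def higher_pderiv_diff poly_diff
    by (rule member_le_sum[of k "{0..m-1}"]) (use k in auto)
  then have "?d powr p \<le> w * ?h powr ((real m - real k) * p - 1)"
    using w \<open>x < y\<close> by (simp add: pos_divide_le_eq) (meson mult_right_mono order_trans powr_ge_zero)
  then have "(?d powr p) powr (1 / p) \<le> (w * ?h powr ((real m - real k) * p - 1)) powr (1 / p)"
    using p by (intro powr_mono2) auto
  also have "\<dots> = w powr (1 / p) * ?h powr (((real m - real k) * p - 1) * (1 / p))"
    using w jet_term_nonneg[of m p P x y] by (simp add: powr_mult powr_powr)
  also have "((real m - real k) * p - 1) * (1 / p) = real m - real k - 1 / p"
    using p by (simp add: field_simps)
  finally show ?thesis using p by (simp add: powr_powr)
qed

text \<open>Adjoining the unbounded components of the complement of \<open>E\<close>, with the field constant on each of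
  them, leaves only bounded gaps.\<close>

definition with_rays :: "real set \<Rightarrow> real set" where
  "with_rays E = E \<union> {x. \<forall>e\<in>E. e \<le> x} \<union> {x. \<forall>e\<in>E. x \<le> e}"

text \<open>Meaningful for closed nonempty \<open>E\<close> and \<open>x\<close> in
  \<open>with_rays E\<close>, where it is the point of \<open>E\<close> nearest to \<open>x\<close>,
  from which the field is copied.\<close>

definition nearest :: "real set \<Rightarrow> real \<Rightarrow> real" where
  "nearest E x = (if x \<in> E then x else if \<forall>e\<in>E. e \<le> x then Sup E else Inf E)"

lemma closed_with_rays: "closed E \<Longrightarrow> closed (with_rays E)"
proof -
  have "{x. \<forall>e\<in>E. e \<le> x} = (\<Inter>e\<in>E. {e..})" "{x. \<forall>e\<in>E. x \<le> e} = (\<Inter>e\<in>E. {..e})" by auto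
  then show "closed E \<Longrightarrow> closed (with_rays E)"
    by (auto simp: with_rays_def intro!: closed_Un closed_INT)
qed

lemma nearest_cases:
  assumes E: "closed E" "E \<noteq> {}" and x: "x \<in> with_rays E"
  obtains "x \<in> E" "nearest E x = x"
  | "x \<notin> E" "\<And>e. e \<in> E \<Longrightarrow> e \<le> x" "nearest E x = Sup E" "Sup E \<in> E" "Sup E \<le> x" "\<And>e. e \<in> E \<Longrightarrow> e \<le> Sup E"
  | "x \<notin> E" "\<And>e. e \<in> E \<Longrightarrow> x \<le> e" "nearest E x = Inf E" "Inf E \<in> E" "x \<le> Inf E" "\<And>e. e \<in> E \<Longrightarrow> Inf E \<le> e"
proof -
  consider "x \<in> E" | "x \<notin> E" "\<forall>e\<in>E. e \<le> x" | "x \<notin> E" "\<not> (\<forall>e\<in>E. e \<le> x)" "\<forall>e\<in>E. x \<le> e"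
    using x by (auto simp: with_rays_def)
  then show thesis
  proof cases
    case 1
    then show ?thesis by (intro that(1)) (auto simp: nearest_def)
  next
    case 2
    then have bdd: "bdd_above E" by (intro bdd_aboveI[of _ x]) blast
    show ?thesis
    proof (rule that(2))
      show "Sup E \<in> E" using E bdd by (intro closed_contains_Sup) auto
      then show "Sup E \<le> x" using 2 by blast
    qed (use 2 bdd in \<open>auto simp: nearest_def intro: cSup_upper\<close>)
  next
    case 3
    then have bdd: "bdd_below E" by (intro bdd_belowI[of _ x]) blast
    show ?thesis
    proof (rule that(3))
      show "Inf E \<in> E" using E bdd by (intro closed_contains_Inf) auto
      then show "x \<le> Inf E" using 3 by blast
    qed (use 3 bdd in \<open>auto simp: nearest_def intro: cInf_lower\<close>)
  qed
qed

lemma nearest_in: "closed E \<Longrightarrow> E \<noteq> {} \<Longrightarrow> x \<in> with_rays E \<Longrightarrow> nearest E x \<in> E"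
  by (erule (2) nearest_cases) auto

text \<open>Either the copied polynomials coincide, or the nearest points lie between
  \<open>x\<close> and \<open>y\<close>; then their distance is at most \<open>y - x\<close>, and
  estimates on \<open>E\<close> carry over to the enlarged set.\<close>

lemma nearest_order:
  assumes E: "closed E" "E \<noteq> {}" and xy: "x \<in> with_rays E" "y \<in> with_rays E" "x < y"
  shows "nearest E x = nearest E y \<or> (x \<le> nearest E x \<and> nearest E x < nearest E y \<and> nearest E y \<le> y)"
  using E(2) xy(3)
  by (rule_tac nearest_cases[OF E xy(1)]; rule_tac nearest_cases[OF E xy(2)]) force+

text \<open>\<open>C\<close> is built from the interpolation constant, which depends only on
  \<open>m\<close>, before \<open>p\<close>, \<open>E\<close> and \<open>P\<close> are given. The
  condition \<open>C \<ge> 2 * real m\<close> lets the same constant serve necessity.\<close>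

theorem Whitney_extension:
  fixes m :: nat
  assumes m: "m \<ge> 1"
  obtains C :: real where "C \<ge> 2 * real m"
    "\<forall>p E P N. p > 1 \<longrightarrow> closed E \<longrightarrow> E \<noteq> {} \<longrightarrow> whitney_field (m - 1) E P \<longrightarrow> N \<ge> 0 \<longrightarrow>
      variation_quantity m p E P \<le> ennreal N \<longrightarrow>
      (\<exists>F. C_diff (m - 1) F \<and> F \<in> sobolev m p \<and> (\<forall>x\<in>E. taylor_poly (m - 1) x F = P x) \<and>
        sobolev_seminorm m p F \<le> C * N)"
proof -
  obtain K where K: "K \<ge> 1" and "\<forall>a b A B. \<exists>H. a < b \<longrightarrow> degree A < m \<longrightarrow> degree B < m \<longrightarrow>
    (\<forall>\<beta> c. c \<in> {a..b} \<longrightarrow> jet_le (b - a) \<beta> (A - B) c \<longrightarrow>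
      (\<forall>z\<in>{a..b}. \<forall>i\<le>m. \<bar>poly ((pderiv ^^ i) (H - A)) z\<bar> \<le> K * \<beta> / (b - a) ^ m * (z - a) ^ (m - i) \<and>
        \<bar>poly ((pderiv ^^ i) (H - B)) z\<bar> \<le> K * \<beta> / (b - a) ^ m * (b - z) ^ (m - i)))"
    using gap_interpolation[of m] by blast
  then obtain H where H: "\<forall>a b A B. a < b \<longrightarrow> degree A < m \<longrightarrow> degree B < m \<longrightarrow>
    (\<forall>\<beta> c. c \<in> {a..b} \<longrightarrow> jet_le (b - a) \<beta> (A - B) c \<longrightarrow>
      (\<forall>z\<in>{a..b}. \<forall>i\<le>m. \<bar>poly ((pderiv ^^ i) (H a b A B - A)) z\<bar> \<le> K * \<beta> / (b - a) ^ m * (z - a) ^ (m - i) \<and>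
        \<bar>poly ((pderiv ^^ i) (H a b A B - B)) z\<bar> \<le> K * \<beta> / (b - a) ^ m * (b - z) ^ (m - i)))"
    unfolding choice_iff by blast
  show thesis
  proof (rule that[of "2 * (K + real m)"], goal_cases)
    case 1
    then show ?case using K by simp
  next
    case 2
    show ?case
    proof (intro allI impI)
      fix p N :: real and E P
      assume p: "p > 1" and E: "closed E" "E \<noteq> {}" and P: "whitney_field (m - 1) E P" and N0: "N \<ge> 0"
        and N: "variation_quantity m p E P \<le> ennreal N"
      let ?n = "nearest E" and ?W = "variation_upto m p E P"
      note n_in = nearest_in[OF E]
      have W_le: "?W x \<le> ?W y" if "x \<in> E" "y \<in> E" "x \<le> y" for x y
        using variation_upto_step[OF N N0 p that(1,2)] jet_term_nonneg[of m p P x y] that(3)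
        by (cases "x = y") auto
      interpret whitney_data m p "with_rays E" "\<lambda>x. P (?n x)" "\<lambda>x. ?W (?n x)" "N powr p" K H
      \<comment> \<open>Cases are numbered as the assumptions of the locale: 4 and 5 say that there
        are no unbounded gaps, 9 is \<open>near\<close>, and 11 is the interpolation bound.\<close>
      proof (unfold_locales, goal_cases)
        case (4 y)
        show ?case
        proof (cases "\<exists>e\<in>E. e \<le> y")
          case False
          then have "y \<in> with_rays E" by (auto simp: with_rays_def)
          then show ?thesis by blast
        qed (auto simp: with_rays_def)
      next
        case (5 y)
        show ?case
        proof (cases "\<exists>e\<in>E. y \<le> e")
          case False
          then have "y \<in> with_rays E" by (auto simp: with_rays_def)
          then show ?thesis by blast
        qed (auto simp: with_rays_def)
      next
        case (6 x)
        then show ?case using P n_in[of x] m by (fastforce simp: whitney_field_def)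
      next
        case (7 x y)
        then show ?case
          using nearest_order[OF E, of x y] n_in W_le by (cases "x = y") force+
      next
        case (8 x)
        then show ?case using variation_upto_range[OF N N0 p n_in] by simp
      next
        case (9 x y)
        have expo: "0 \<le> real m - real k - 1 / p" if "k < m" for k
        proof -
          have "1 \<le> real m - real k" using that by linarith
          moreover have "1 / p \<le> 1" using p by simp
          ultimately show ?thesis by linarith
        qed
        from nearest_order[OF E 9] show ?case
        proof
          assume "?n x = ?n y"
          then show ?thesis using 9 by (intro bexI[of _ x]) auto
        next
          assume n: "x \<le> ?n x \<and> ?n x < ?n y \<and> ?n y \<le> y"
          have "jet_term m p P (?n x) (?n y) \<le> ?W (?n y) - ?W (?n x)"
            using variation_upto_step[OF N N0 p n_in[OF 9(1)] n_in[OF 9(2)]] n by simp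
          then have "\<bar>poly ((pderiv ^^ k) (P (?n x) - P (?n y))) (?n x)\<bar>
              \<le> (?W (?n y) - ?W (?n x)) powr (1 / p) * (?n y - ?n x) powr (real m - real k - 1 / p)" if "k < m" for k
            using n by (intro jet_difference_le[OF p that]) auto
          moreover have "(?n y - ?n x) powr (real m - real k - 1 / p) \<le> (y - x) powr (real m - real k - 1 / p)"
            if "k < m" for k
            using n expo[OF that] by (intro powr_mono2) auto
          ultimately have "\<bar>poly ((pderiv ^^ k) (P (?n x) - P (?n y))) (?n x)\<bar>
              \<le> (?W (?n y) - ?W (?n x)) powr (1 / p) * (y - x) powr (real m - real k - 1 / p)" if "k < m" for k
            using that by (meson mult_left_mono order_trans powr_ge_zero)
          \<comment> \<open>The comparison point is \<open>?n x\<close>, which differs from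
            \<open>x\<close> when \<open>x\<close> lies on the left ray.\<close>
          then show ?thesis using n by (intro bexI[of _ "?n x"]) auto
        qed
      next
        case (11 a b A B \<beta> c z i)
        then show ?case using H by blast
      qed (use m p E K closed_with_rays in auto)
      have "taylor_poly (m - 1) x (f 0) = P x" if "x \<in> E" for x
        using extension(3)[of x] that by (simp add: with_rays_def nearest_def)
      moreover have "sobolev_seminorm m p (f 0) \<le> 2 * (K + real m) * N"
        using extension(4) p N0 by (simp add: powr_powr)
      ultimately show "\<exists>F. C_diff (m - 1) F \<and> F \<in> sobolev m p \<and> (\<forall>x\<in>E. taylor_poly (m - 1) x F = P x) \<and>
          sobolev_seminorm m p F \<le> 2 * (K + real m) * N"
        using extension(1,2) by blast
    qed
  qed
qed

section \<open>Equivalence and comparison of the two quantities\<close>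

theorem theorem4p1:
  fixes m :: nat
  assumes "m \<ge> 1"
  shows "\<exists>C::real. C \<ge> 1 \<and>
    (\<forall>(p::real) (E::real set) (P::real \<Rightarrow> real poly).
       1 < p \<and> closed E \<and> E \<noteq> {} \<and> whitney_field (m - 1) E P \<longrightarrow>
         ((\<exists>F. C_diff (m - 1) F \<and> F \<in> sobolev m p \<and> (\<forall>x\<in>E. taylor_poly (m - 1) x F = P x))
            \<longleftrightarrow> variation_quantity m p E P < \<infinity>) \<and>
         field_norm m p E P \<le> ennreal C * variation_quantity m p E P \<and>
         variation_quantity m p E P \<le> ennreal C * field_norm m p E P)"
proof -
  obtain C where C: "C \<ge> 2 * real m" and ext: "\<forall>p E P N. p > 1 \<longrightarrow> closed E \<longrightarrow> E \<noteq> {} \<longrightarrow>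
      whitney_field (m - 1) E P \<longrightarrow> N \<ge> 0 \<longrightarrow> variation_quantity m p E P \<le> ennreal N \<longrightarrow>
      (\<exists>F. C_diff (m - 1) F \<and> F \<in> sobolev m p \<and> (\<forall>x\<in>E. taylor_poly (m - 1) x F = P x) \<and>
        sobolev_seminorm m p F \<le> C * N)"
    using Whitney_extension[OF assms] by metis
  have C1: "C \<ge> 1" using C assms by simp
  show ?thesis
  proof (intro exI[of _ C] conjI C1 allI impI; elim conjE)
    fix p :: real and E :: "real set" and P :: "real \<Rightarrow> real poly"
    assume p: "1 < p" and E: "closed E" "E \<noteq> {}" and P: "whitney_field (m - 1) E P"
    have le: "variation_quantity m p E P \<le> ennreal C * ennreal (sobolev_seminorm m p F)"
      if "F \<in> sobolev m p" "\<forall>x\<in>E. taylor_poly (m - 1) x F = P x" for F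
    proof -
      have "variation_quantity m p E P \<le> ennreal (2 * real m) * ennreal (sobolev_seminorm m p F)"
        using that by (intro variation_quantity_le[OF assms p]) auto
      also have "\<dots> \<le> ennreal C * ennreal (sobolev_seminorm m p F)"
        using C by (intro mult_right_mono ennreal_leI) auto
      finally show ?thesis .
    qed
    have fin: "\<exists>F. C_diff (m - 1) F \<and> F \<in> sobolev m p \<and> (\<forall>x\<in>E. taylor_poly (m - 1) x F = P x) \<and>
        ennreal (sobolev_seminorm m p F) \<le> ennreal C * variation_quantity m p E P"
      if "variation_quantity m p E P < \<infinity>"
    proof -
      let ?N = "enn2real (variation_quantity m p E P)"
      have eq: "ennreal ?N = variation_quantity m p E P" using that by simp
      then obtain F where "C_diff (m - 1) F" "F \<in> sobolev m p" "\<forall>x\<in>E. taylor_poly (m - 1) x F = P x"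
        and "sobolev_seminorm m p F \<le> C * ?N"
        using ext[rule_format, OF p E P, of ?N] by auto
      moreover from this(4) have "ennreal (sobolev_seminorm m p F) \<le> ennreal C * variation_quantity m p E P"
        using C1 by (subst eq[symmetric]) (simp add: ennreal_mult[symmetric] ennreal_leI del: ennreal_enn2real)
      ultimately show ?thesis by blast
    qed
    show "(\<exists>F. C_diff (m - 1) F \<and> F \<in> sobolev m p \<and> (\<forall>x\<in>E. taylor_poly (m - 1) x F = P x))
        \<longleftrightarrow> variation_quantity m p E P < \<infinity>"
    proof
      assume "\<exists>F. C_diff (m - 1) F \<and> F \<in> sobolev m p \<and> (\<forall>x\<in>E. taylor_poly (m - 1) x F = P x)"
      then obtain F where F: "F \<in> sobolev m p" "\<forall>x\<in>E. taylor_poly (m - 1) x F = P x" by blast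
      have "ennreal C * ennreal (sobolev_seminorm m p F) < \<infinity>" by (simp add: ennreal_mult_less_top)
      with le[OF F] show "variation_quantity m p E P < \<infinity>" by (rule le_less_trans)
    qed (use fin in blast)
    show "field_norm m p E P \<le> ennreal C * variation_quantity m p E P"
    proof (cases "variation_quantity m p E P < \<infinity>")
      case True
      from fin[OF this] obtain F where "F \<in> sobolev m p" "\<forall>x\<in>E. taylor_poly (m - 1) x F = P x"
        "ennreal (sobolev_seminorm m p F) \<le> ennreal C * variation_quantity m p E P" by blast
      then show ?thesis unfolding field_norm_def by (intro INF_lower2[of F]) auto
    next
      case False
      then have "variation_quantity m p E P = \<infinity>" by (simp add: less_top[symmetric])
      then show ?thesis using C1 by (simp add: ennreal_mult_top ennreal_mult_eq_top_iff)
    qed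
    \<comment> \<open>With the constant on the left, the estimate for each \<open>F\<close> passes
      directly to the infimum, also when no extension exists and the infimum is infinite.\<close>
    have "ennreal (1 / C) * variation_quantity m p E P \<le> field_norm m p E P"
      unfolding field_norm_def
    proof (rule INF_greatest)
      fix F assume "F \<in> {F \<in> sobolev m p. \<forall>x\<in>E. taylor_poly (m - 1) x F = P x}"
      then have "ennreal (1 / C) * variation_quantity m p E P
          \<le> ennreal (1 / C) * (ennreal C * ennreal (sobolev_seminorm m p F))"
        by (intro mult_left_mono le) auto
      also have "\<dots> = ennreal (sobolev_seminorm m p F)"
        using C1 by (simp add: mult.assoc[symmetric] ennreal_mult[symmetric])
      finally show "ennreal (1 / C) * variation_quantity m p E P \<le> ennreal (sobolev_seminorm m p F)" .
    qed
    then have "ennreal C * (ennreal (1 / C) * variation_quantity m p E P) \<le> ennreal C * field_norm m p E P"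
      by (intro mult_left_mono) auto
    then show "variation_quantity m p E P \<le> ennreal C * field_norm m p E P"
      using C1 by (simp add: mult.assoc[symmetric] ennreal_mult[symmetric])
  qed
qed

end
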